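(* Let $k,m\geq 3$ be integers. If $S$ is an ai-semiring such that $\mathsf{V}(S_c(a_1\cdots a_k))\subseteq\mathsf{V}(S)\subseteq\mathcal{W}_{k,m}$, then $S$ and $S^0$ are both nonfinitely based.
   Context: An ai-semiring is an algebra $(S,+,\cdot)$ with two binary operations (no constants in the signature) such that $(S,+)$ is a commutative idempotent semigroup, $(S,\cdot)$ is a semigroup, and $x(y+z)\approx xy+xz$, $(x+y)z\approx xz+yz$ hold. $\mathsf{V}(S)$ is the variety of ai-semirings generated by $S$. A variety is finitely based if it can be defined by a finite set of identities, and nonfinitely based otherwise; an ai-semiring $S$ is (non)finitely based if $\mathsf{V}(S)$ is. For an ai-semiring $S$, $S^0=S\cup\{0\}$ is the ai-semiring obtained by adjoining a new element $0$ with $s+0=0+s=s$ and $s0=0s=0$ for all $s\in S\cup\{0\}$, the operations on $S$ being preserved. (If $S$ already has an element called $0$, the adjoined one is a different new element.) $S_c(a_1\cdots a_k)$, for distinct letters $a_1,\dots,a_k$: its elements are all nonempty subwords of the commutative word $a_1\cdots a_k$ (i.e. the products $\prod_{i\in A}a_i$, $\emptyset\neq A\subseteq\{1,\dots,k\}$, in the free commutative semigroup) together with a symbol $0$. The product of two words is their product in the free commutative semigroup if this is again a subword of $a_1\cdots a_k$, and $0$ otherwise; $0$ is the multiplicative zero; $x+x=x$ and $x+y=0$ for $x\neq y$. Hypergraphs: a hypergraph is a pair $(V,E)$ with $E$ a family of nonempty subsets (hyperedges) of $V$; it is $k$-uniform if every hyperedge has $k$ elements. A cycle of length $n\geq 2$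 is an alternating sequence $v_0,e_1,v_1,\dots,e_n,v_n$ with $v_0=v_n$, $v_0,\dots,v_{n-1}$ distinct vertices, $e_1,\dots,e_n$ distinct hyperedges, and $\{v_{i-1},v_i\}\subseteq e_i$ for $1\leq i\leq n$. The girth is the length of a shortest cycle ($\infty$ if there is none). A hypergraph is $m$-colourable if there is a map $\varphi:V\to\{1,\dots,m\}$ with $|\varphi(e)|\geq 2$ for all $e\in E$ with $|e|\geq 2$. For all integers $k,m,n\geq 3$, $\mathbb{H}_n=\mathbb{H}_n^{(k,m)}=(V_n,E_n)$ is a fixed finite $k$-uniform hypergraph without isolated vertices that has girth greater than $k\binom{kn}{2}$ and is not $m$-colourable (such hypergraphs exist by Erdős–Hajnal). For a finite $k$-uniform hypergraph $\mathbb{H}=(V,E)$, with a variable $x_v$ for each $v\in V$, $\mathbf{t}_{\mathbb{H}}$ is the ai-semiring term that is the sum of all words $x_{v_1}\cdots x_{v_k}$ with $\{v_1,\dots,v_k\}\in E$ (all $k!$ orderings of each hyperedge), and $\mathbf{q}_{\mathbb{H}}$ is the word $\prod_{v\in V}x_v$ (in any fixed order). $\mathcal{W}_{k,m}$ is the ai-semiring variety defined by the identities $\mathbf{t}_{\mathbb{H}_n}\approx\mathbf{t}_{\mathbb{H}_n}+\mathbf{q}_{\mathbb{H}_n}$ for all $n\geq 3$. *)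

theory Defs
  imports
    Complex_Main
    "HOL-Library.Multiset"
    "HOL-Library.Extended_Nat"
    "HOL-Library.Infinite_Typeclass"
begin

section \<open>Ai-semirings\<close>

record 'a ai_alg =
  elems :: "'a set"
  add :: "'a \<Rightarrow> 'a \<Rightarrow> 'a"
  mul :: "'a \<Rightarrow> 'a \<Rightarrow> 'a"

locale ai_semiring =
  fixes S :: "'a ai_alg"
  assumes nonempty: "elems S \<noteq> {}"
    and add_closed: "\<lbrakk>x \<in> elems S; y \<in> elems S\<rbrakk> \<Longrightarrow> add S x y \<in> elems S"
    and mul_closed: "\<lbrakk>x \<in> elems S; y \<in> elems S\<rbrakk> \<Longrightarrow> mul S x y \<in> elems S"
    and add_assoc: "\<lbrakk>x \<in> elems S; y \<in> elems S; z \<in> elems S\<rbrakk>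
      \<Longrightarrow> add S (add S x y) z = add S x (add S y z)"
    and add_comm: "\<lbrakk>x \<in> elems S; y \<in> elems S\<rbrakk> \<Longrightarrow> add S x y = add S y x"
    and add_idem: "x \<in> elems S \<Longrightarrow> add S x x = x"
    and mul_assoc: "\<lbrakk>x \<in> elems S; y \<in> elems S; z \<in> elems S\<rbrakk>
      \<Longrightarrow> mul S (mul S x y) z = mul S x (mul S y z)"
    and distrib_left: "\<lbrakk>x \<in> elems S; y \<in> elems S; z \<in> elems S\<rbrakk>
      \<Longrightarrow> mul S x (add S y z) = add S (mul S x y) (mul S x z)"
    and distrib_right: "\<lbrakk>x \<in> elems S; y \<in> elems S; z \<in> elems S\<rbrakk>
      \<Longrightarrow> mul S (add S x y) z = add S (mul S x z) (mul S y z)"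

text \<open>The new element is \<open>None\<close>.\<close>

definition adjoin_zero :: "'a ai_alg \<Rightarrow> 'a option ai_alg" where
  "adjoin_zero S =
    \<lparr> elems = insert None (Some ` elems S),
      add = (\<lambda>x y. case (x, y) of
        (Some a, Some b) \<Rightarrow> Some (add S a b)
      | (Some a, None) \<Rightarrow> Some a
      | (None, y) \<Rightarrow> y),
      mul = (\<lambda>x y. case (x, y) of
        (Some a, Some b) \<Rightarrow> Some (mul S a b)
      | _ \<Rightarrow> None) \<rparr>"

text \<open>Commutative words are multisets of letters and subwords are submultisets.
  The element \<open>0\<close> of \<open>S\<^sub>c(W)\<close> is \<open>None\<close>.\<close>

definition S_c :: "'l multiset \<Rightarrow> 'l multiset option ai_alg" where
  "S_c W =
    \<lparr> elems = insert None (Some ` {M. M \<noteq> {#} \<and> M \<subseteq># W}),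
      add = (\<lambda>x y. if x = y then x else None),
      mul = (\<lambda>x y. case (x, y) of
        (Some M, Some N) \<Rightarrow> if M + N \<subseteq># W then Some (M + N) else None
      | _ \<Rightarrow> None) \<rparr>"

lemma ai_semiring_adjoin_zero:
  assumes "ai_semiring S"
  shows "ai_semiring (adjoin_zero S)"
proof -
  interpret ai_semiring S by fact
  show ?thesis
    by unfold_locales
      (auto simp: adjoin_zero_def add_closed mul_closed add_assoc add_idem mul_assoc
        distrib_left distrib_right intro: add_comm split: option.splits)
qed

lemma ai_semiring_S_c: "ai_semiring (S_c W)"
proof
  have dvd: "M \<subseteq># W" "N \<subseteq># W" if "M + N \<subseteq># W" for M N :: "'a multiset"
    using that by (meson mset_subset_eq_add_left mset_subset_eq_add_right subset_mset.order_trans)+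
  fix x y z
  show "mul (S_c W) (mul (S_c W) x y) z = mul (S_c W) x (mul (S_c W) y z)"
    by (auto simp: S_c_def add.assoc split: option.splits dest: dvd)
      (metis add.assoc dvd)+
qed (auto simp: S_c_def split: option.splits if_splits)

section \<open>Terms, identities and varieties\<close>

datatype 'x ai_term = Var 'x | Plus "'x ai_term" "'x ai_term" | Times "'x ai_term" "'x ai_term"

primrec eval :: "'a ai_alg \<Rightarrow> ('x \<Rightarrow> 'a) \<Rightarrow> 'x ai_term \<Rightarrow> 'a" where
  "eval S f (Var x) = f x"
| "eval S f (Plus s t) = add S (eval S f s) (eval S f t)"
| "eval S f (Times s t) = mul S (eval S f s) (eval S f t)"

text \<open>The pair \<open>(s, t)\<close> is the identity \<open>s \<approx> t\<close>.\<close>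

type_synonym 'x ai_identity = "'x ai_term \<times> 'x ai_term"

definition satisfies :: "'a ai_alg \<Rightarrow> 'x ai_identity \<Rightarrow> bool" where
  "satisfies S = (\<lambda>(s, t). \<forall>f. range f \<subseteq> elems S \<longrightarrow> eval S f s = eval S f t)"

text \<open>A class of ai-semirings is represented by the set of its members with elements in a type
  \<open>'u\<close>. When \<open>'u\<close> is infinite this loses nothing for varieties: each variety is determined by
  its countable members.\<close>

definition variety_defined_by :: "'x ai_identity set \<Rightarrow> 'u ai_alg set" where
  "variety_defined_by \<Sigma> = {A. ai_semiring A \<and> (\<forall>i\<in>\<Sigma>. satisfies A i)}"

text \<open>The least variety containing \<open>S\<close>; it has its own universe type, so that varieties
  generated by ai-semirings over different types are comparable.
  Countably many variables are enough for identities.\<close>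

definition generated_variety :: "'a ai_alg \<Rightarrow> 'u ai_alg set" where
  "generated_variety S =
    \<Inter> {variety_defined_by \<Sigma> | \<Sigma> :: nat ai_identity set. \<forall>i\<in>\<Sigma>. satisfies S i}"

definition finitely_based :: "'u ai_alg set \<Rightarrow> bool" where
  "finitely_based K \<longleftrightarrow>
    (\<exists>\<Sigma> :: nat ai_identity set. finite \<Sigma> \<and> K = variety_defined_by \<Sigma>)"

lemma generated_variety_eq:
  "generated_variety S = variety_defined_by {i :: nat ai_identity. satisfies S i}"
proof
  show "generated_variety S \<subseteq> variety_defined_by {i :: nat ai_identity. satisfies S i}"
    unfolding generated_variety_def by (rule Inter_lower) auto
  show "variety_defined_by {i :: nat ai_identity. satisfies S i} \<subseteq> generated_variety S"
    unfolding generated_variety_def variety_defined_by_def by blast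
qed

lemma in_generated_variety:
  "ai_semiring S \<Longrightarrow> S \<in> generated_variety S"
  by (simp add: generated_variety_eq variety_defined_by_def)

lemma generated_variety_least:
  fixes \<Sigma> :: "nat ai_identity set"
  assumes "S \<in> variety_defined_by \<Sigma>"
  shows "generated_variety S \<subseteq> variety_defined_by \<Sigma>"
  using assms by (auto simp: generated_variety_eq variety_defined_by_def)

section \<open>Hypergraphs\<close>

type_synonym 'v hypergraph_pair = "'v set \<times> 'v set set"

definition hypergraph :: "'v hypergraph_pair \<Rightarrow> bool" where
  "hypergraph = (\<lambda>(V, E). \<forall>e\<in>E. e \<noteq> {} \<and> e \<subseteq> V)"

definition uniform :: "nat \<Rightarrow> 'v hypergraph_pair \<Rightarrow> bool" where
  "uniform k = (\<lambda>(V, E). \<forall>e\<in>E. finite e \<and> card e = k)"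

definition no_isolated_vertices :: "'v hypergraph_pair \<Rightarrow> bool" where
  "no_isolated_vertices = (\<lambda>(V, E). \<forall>v\<in>V. \<exists>e\<in>E. v \<in> e)"

definition is_cycle :: "'v hypergraph_pair \<Rightarrow> nat \<Rightarrow> (nat \<Rightarrow> 'v) \<Rightarrow> (nat \<Rightarrow> 'v set) \<Rightarrow> bool" where
  "is_cycle = (\<lambda>(V, E) n v e. 2 \<le> n \<and> v 0 = v n
    \<and> v ` {..<n} \<subseteq> V \<and> inj_on v {..<n}
    \<and> e ` {1..n} \<subseteq> E \<and> inj_on e {1..n}
    \<and> (\<forall>i\<in>{1..n}. {v (i - 1), v i} \<subseteq> e i))"

text \<open>The infimum of the empty set is \<open>\<infinity>\<close>.\<close>

definition girth :: "'v hypergraph_pair \<Rightarrow> enat" where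
  "girth H = Inf {enat n | n. \<exists>v e. is_cycle H n v e}"

definition colourable :: "nat \<Rightarrow> 'v hypergraph_pair \<Rightarrow> bool" where
  "colourable m = (\<lambda>(V, E). \<exists>\<phi> :: 'v \<Rightarrow> nat. \<phi> ` V \<subseteq> {1..m}
    \<and> (\<forall>e\<in>E. infinite e \<or> 2 \<le> card e \<longrightarrow> 2 \<le> card (\<phi> ` e)))"

text \<open>The conditions on the hypergraph \<open>\<bbbH>\<^sub>n\<close> for parameters \<open>k\<close> and \<open>m\<close>.\<close>

definition admissible :: "nat \<Rightarrow> nat \<Rightarrow> nat \<Rightarrow> 'v hypergraph_pair \<Rightarrow> bool" where
  "admissible k m n H \<longleftrightarrow> hypergraph H \<and> finite (fst H) \<and> uniform k H
    \<and> no_isolated_vertices H \<and> girth H > enat (k * ((k * n) choose 2)) \<and> \<not> colourable m H"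

section \<open>The varieties defined by hypergraphs\<close>

text \<open>Both functions are meant for nonempty lists only.\<close>

fun word :: "'x list \<Rightarrow> 'x ai_term" where
  "word [x] = Var x"
| "word (x # y # ys) = Times (Var x) (word (y # ys))"

fun sum_terms :: "'x ai_term list \<Rightarrow> 'x ai_term" where
  "sum_terms [t] = t"
| "sum_terms (t # u # us) = Plus t (sum_terms (u # us))"

text \<open>The order of the summands is irrelevant in ai-semirings, so an arbitrary one is chosen.\<close>

definition sum_words :: "'x list set \<Rightarrow> 'x ai_term" where
  "sum_words W = sum_terms (map word (SOME ws. distinct ws \<and> set ws = W))"

definition t_term :: "nat \<Rightarrow> 'v hypergraph_pair \<Rightarrow> 'v ai_term" where
  "t_term k = (\<lambda>(V, E). sum_words {vs. length vs = k \<and> set vs \<in> E})"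

text \<open>The list \<open>vs n\<close> enumerates the vertices of \<open>H n\<close> and thus fixes the order of the letters
  in \<open>q\<close>.\<close>

definition W_variety ::
    "nat \<Rightarrow> (nat \<Rightarrow> 'v hypergraph_pair) \<Rightarrow> (nat \<Rightarrow> 'v list) \<Rightarrow> 'u ai_alg set" where
  "W_variety k H vs = variety_defined_by
    {(t_term k (H n), Plus (t_term k (H n)) (word (vs n))) | n. 3 \<le> n}"

end

theory Submission
  imports Defs
begin

text \<open>Let \<open>T\<close> be \<open>S\<close> or \<open>S\<^sup>0\<close>. Both satisfy the identities of \<open>S\<^sup>0\<close> and the identities
  \<open>\<^bold>t \<approx> \<^bold>t + \<^bold>q\<close> of the hypergraphs \<open>\<bbbH>\<^sub>n\<close>; for \<open>S\<^sup>0\<close> the reason is that \<open>\<^bold>q\<close> takes the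
  additively neutral value \<open>0\<close> as soon as one variable does. Every identity of \<open>T\<close> holds in
  \<open>S\<^sub>c(a\<^sub>1 \<dots> a\<^sub>k)\<close>. Hence \<open>T\<close> is nonfinitely based if for each finite set \<open>\<Sigma>\<close> of identities of
  \<open>S\<^sub>c(a\<^sub>1 \<dots> a\<^sub>k)\<close> there are an \<open>n\<close> and an ai-semiring that satisfies \<open>\<Sigma>\<close> but not
  \<open>\<^bold>t \<approx> \<^bold>t + \<^bold>q\<close> for \<open>\<bbbH>\<^sub>n\<close>.

  This ai-semiring is the syntactic ai-semiring of the set \<open>L\<close> of edges of \<open>\<bbbH>\<^sub>n\<close>, regarded
  as a language of commutative words over the vertices. Sets of nonempty commutative words are
  added by union and multiplied elementwise, and two such sets are identified if the same words
  extend all their members to members of \<open>L\<close>. Assign to each variable the class of its own vertex.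
  All words of \<open>\<^bold>t\<close> become edges, but the word \<open>\<^bold>q\<close> becomes the set of all vertices, which is not an
  edge because \<open>\<bbbH>\<^sub>n\<close> is not colourable. So the identity fails
  (\<open>syntactic_words\<close>).

  It remains to see that an identity \<open>s \<approx> t\<close> of \<open>S\<^sub>c(a\<^sub>1 \<dots> a\<^sub>k)\<close> holds in the syntactic
  ai-semiring once the girth is large in terms of \<open>s\<close> and \<open>t\<close> (\<open>contexts_transfer\<close>).
  Suppose that, under some substitution, a context \<open>P\<close> turns all words of \<open>s\<close> into edges, and take a
  word \<open>N\<close> obtained from \<open>t\<close>. Only a bounded number of edges is needed to witness how the factors of
  \<open>N\<close> are related to the words of \<open>s\<close>. By the girth condition they form a cycle-free hypergraph, and
  each colouring of its vertices with \<open>k\<close> colours that is injective on its edges yields an assignment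
  into \<open>S\<^sub>c(a\<^sub>1 \<dots> a\<^sub>k)\<close> under which \<open>s\<close> is nonzero. Since \<open>s \<approx> t\<close> holds there, \<open>N + P\<close> contains
  each colour exactly once. This is true for all such colourings, and in a cycle-free hypergraph
  with \<open>k \<ge> 3\<close> only edges have this property (\<open>always_rainbow_imp_edge\<close>): two vertices that
  lie in no common edge can be given the same colour (\<open>cycle_free_rainbow\<close>), and pairwise adjacent
  vertices lie in a single edge because there are no triangles.\<close>

section \<open>Cycle-free hypergraphs\<close>
definition cycle_free :: "'v set set \<Rightarrow> bool" where
  "cycle_free F \<longleftrightarrow> (\<nexists>n v e. is_cycle (UNIV, F) n v e)"

lemma cycle_free_subset: "cycle_free F \<Longrightarrow> G \<subseteq> F \<Longrightarrow> cycle_free G"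
  unfolding cycle_free_def is_cycle_def prod.case by (meson order_trans)

lemma cycle_free_if_card_less_girth:
  assumes "hypergraph (V, E)" "F \<subseteq> E" "finite F" "enat (card F) < girth (V, E)"
  shows "cycle_free F"
proof (rule ccontr)
  assume "\<not> cycle_free F"
  then obtain n v e where c: "is_cycle (UNIV, F) n v e" by (auto simp: cycle_free_def)
  have "v i \<in> V" if "i < n" for i
  proof -
    have "Suc i \<in> {1..n}" using that by auto
    moreover from this have "{v (Suc i - 1), v (Suc i)} \<subseteq> e (Suc i)"
      using c unfolding is_cycle_def prod.case by blast
    moreover have "e ` {1..n} \<subseteq> E" using c assms(2) by (auto simp: is_cycle_def)
    ultimately have "v i \<in> e (Suc i)" "e (Suc i) \<in> E" by auto
    then show ?thesis using assms(1) by (auto simp: hypergraph_def)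
  qed
  then have "is_cycle (V, E) n v e" using c assms(2) by (auto simp: is_cycle_def)
  then have "girth (V, E) \<le> enat n" unfolding girth_def by (intro Inf_lower) auto
  moreover have "n \<le> card F"
    using card_inj_on_le[of e "{1..n}" F] c assms(3) by (auto simp: is_cycle_def)
  ultimately show False using assms(4) by (metis enat_ord_simps(1) leD order_trans)
qed

text \<open>The part \<open>e 1, v 1, e 2, \<dots>, v (l - 1), e l\<close> of a path that starts and ends with an edge.\<close>
definition trail :: "'v set set \<Rightarrow> nat \<Rightarrow> (nat \<Rightarrow> 'v) \<Rightarrow> (nat \<Rightarrow> 'v set) \<Rightarrow> bool" where
  "trail F l v e \<longleftrightarrow> 1 \<le> l \<and> e ` {1..l} \<subseteq> F \<and> inj_on e {1..l} \<and> inj_on v {1..<l}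
    \<and> (\<forall>i\<in>{1..<l}. v i \<in> e i \<and> v i \<in> e (Suc i))"

text \<open>The last edge of a longest trail is a leaf: if it had a second vertex shared with another
  edge, then the trail could be extended or it would close up to a cycle. If the component of the
  leaf is a single edge, any of its vertices can serve as \<open>x\<close>.\<close>
lemma cycle_free_leaf:
  assumes "cycle_free F" "finite F" "F \<noteq> {}" "{} \<notin> F"
  obtains e x where "e \<in> F" "x \<in> e" "\<And>y f. y \<in> e \<Longrightarrow> f \<in> F \<Longrightarrow> y \<in> f \<Longrightarrow> f = e \<or> y = x"
proof -
  have "\<exists>e\<in>F. \<exists>x. \<forall>y\<in>e. \<forall>f\<in>F. y \<in> f \<longrightarrow> f = e \<or> y = x"
  proof (rule ccontr)
    assume "\<not> ?thesis"
    then have no_leaf: "\<exists>y\<in>a. \<exists>f\<in>F. y \<in> f \<and> f \<noteq> a \<and> y \<noteq> x" if "a \<in> F" for a x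
      using that by metis
    let ?P = "\<lambda>l. \<exists>v e. trail F l v e"
    from \<open>F \<noteq> {}\<close> obtain e0 where "e0 \<in> F" by auto
    then have "trail F 1 (\<lambda>_. undefined) (\<lambda>_. e0)" by (auto simp: trail_def)
    then have ex: "?P 1" by blast
    have bound: "l \<le> card F" if "?P l" for l
      using that card_inj_on_le[of _ "{1..l}" F] \<open>finite F\<close> by (auto simp: trail_def)
    define l where "l = (GREATEST l. ?P l)"
    have "?P l" unfolding l_def by (rule GreatestI_nat[of ?P, OF ex]) (use bound in blast)
    then obtain v e where tr: "trail F l v e" by blast
    have max: "j \<le> l" if "trail F j v' e'" for j v' e'
      unfolding l_def by (rule Greatest_le_nat[of ?P _ "card F"]) (use that bound in blast)+
    have l: "1 \<le> l" and eF: "\<And>i. i \<in> {1..l} \<Longrightarrow> e i \<in> F" and inje: "inj_on e {1..l}"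
      and injv: "inj_on v {1..<l}"
      and adj: "\<And>i. i \<in> {1..<l} \<Longrightarrow> v i \<in> e i" "\<And>i. i \<in> {1..<l} \<Longrightarrow> v i \<in> e (Suc i)"
      using tr by (auto simp: trail_def)
    have "e l \<in> F" using eF l by auto
    then obtain y f where y: "y \<in> e l" "f \<in> F" "y \<in> f" "f \<noteq> e l" "y \<noteq> v (l - 1)"
      using no_leaf[of "e l" "v (l - 1)"] by blast
    consider (old_vertex) i where "i \<in> {1..<l}" "y = v i"
      | (old_edge) i where "i \<in> {1..<l}" "f = e i" "y \<notin> v ` {1..<l}"
      | (new) "y \<notin> v ` {1..<l}" "f \<notin> e ` {1..l}"
    proof (cases "y \<in> v ` {1..<l}")
      case True
      then show thesis using old_vertex by blast
    next
      case y_new: False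
      show thesis
      proof (cases "f \<in> e ` {1..l}")
        case True
        then obtain i where i: "i \<in> {1..l}" "f = e i" by blast
        then have "i \<in> {1..<l}" using y(4) by (cases "i = l") auto
        then show thesis using old_edge i(2) y_new by blast
      next
        case False
        then show thesis using new y_new by blast
      qed
    qed
    then show False
    proof cases
      \<comment> \<open>The trail returns to \<open>v i\<close>: the cycle runs from \<open>v i\<close> through \<open>e (i + 1), \<dots>, e l\<close>.\<close>
      case old_vertex
      then have i: "i < l - 1" using y by (cases "i = l - 1") auto
      let ?n = "l - i"
      let ?v = "\<lambda>j. if j = ?n then y else v (i + j)"
      have "is_cycle (UNIV, F) ?n ?v (\<lambda>j. e (i + j))"
        unfolding is_cycle_def prod.case
      proof (intro conjI)
        show "inj_on ?v {..<?n}"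
        proof (rule inj_onI)
          fix a b assume "a \<in> {..<?n}" "b \<in> {..<?n}" "?v a = ?v b"
          then show "a = b" using inj_onD[OF injv, of "i + a" "i + b"] old_vertex(1) by auto
        qed
        show "inj_on (\<lambda>j. e (i + j)) {1..?n}"
        proof (rule inj_onI)
          fix a b assume "a \<in> {1..?n}" "b \<in> {1..?n}" "e (i + a) = e (i + b)"
          then show "a = b" using inj_onD[OF inje, of "i + a" "i + b"] by auto
        qed
        show "\<forall>j\<in>{1..?n}. {?v (j - 1), ?v j} \<subseteq> e (i + j)"
        proof
          fix j assume j: "j \<in> {1..?n}"
          then obtain j' where j': "j = Suc j'" by (cases j) auto
          have "v (i + (j - 1)) \<in> e (i + j)"
            using adj(2)[of "i + j'"] j j' old_vertex by auto
          moreover have "?v j \<in> e (i + j)"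
            using adj(1)[of "i + j"] j y(1) old_vertex by auto
          ultimately show "{?v (j - 1), ?v j} \<subseteq> e (i + j)" using j by auto
        qed
      qed (use i old_vertex in \<open>auto intro!: eF\<close>)
      then show False using assms(1) by (auto simp: cycle_free_def)
    next
      \<comment> \<open>The trail returns to \<open>e i\<close> at the new vertex \<open>y\<close>: the cycle runs from \<open>y\<close> through
        \<open>e i, \<dots>, e l\<close>.\<close>
      case old_edge
      let ?n = "Suc (l - i)"
      let ?v = "\<lambda>j. if j = 0 \<or> j = ?n then y else v (i + j - 1)"
      have "is_cycle (UNIV, F) ?n ?v (\<lambda>j. e (i + j - 1))"
        unfolding is_cycle_def prod.case
      proof (intro conjI)
        have v_new: "v (i + j - 1) \<noteq> y" if "0 < j" "j < ?n" for j
        proof -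
          have "i + j - 1 \<in> {1..<l}" using that old_edge(1) by auto
          then show ?thesis using old_edge(3) by blast
        qed
        show "inj_on ?v {..<?n}"
        proof (rule inj_onI)
          fix a b assume ab: "a \<in> {..<?n}" "b \<in> {..<?n}" "?v a = ?v b"
          show "a = b"
          proof (cases "a = 0 \<or> b = 0")
            case True
            then show ?thesis using ab v_new[of a] v_new[of b] by (auto split: if_splits)
          next
            case False
            then have "v (i + a - 1) = v (i + b - 1)" "i + a - 1 \<in> {1..<l}" "i + b - 1 \<in> {1..<l}"
              using ab old_edge(1) by auto
            then show ?thesis using inj_onD[OF injv, of "i + a - 1" "i + b - 1"] False by auto
          qed
        qed
        show "inj_on (\<lambda>j. e (i + j - 1)) {1..?n}"
        proof (rule inj_onI)
          fix a b assume ab: "a \<in> {1..?n}" "b \<in> {1..?n}" "e (i + a - 1) = e (i + b - 1)"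
          then have "i + a - 1 \<in> {1..l}" "i + b - 1 \<in> {1..l}" using old_edge(1) by auto
          then show "a = b" using inj_onD[OF inje, of "i + a - 1" "i + b - 1"] ab by auto
        qed
        show "\<forall>j\<in>{1..?n}. {?v (j - 1), ?v j} \<subseteq> e (i + j - 1)"
        proof
          fix j assume j: "j \<in> {1..?n}"
          have "?v (j - 1) \<in> e (i + j - 1)"
          proof (cases "j = 1")
            case True
            then show ?thesis using old_edge y(3) by simp
          next
            case False
            then obtain j' where j': "j = Suc (Suc j')" using j by (cases j; cases "j - 1") auto
            then show ?thesis using adj(2)[of "i + j'"] j old_edge(1) by auto
          qed
          moreover obtain j' where j': "j = Suc j'" using j by (cases j) auto
          have "?v j \<in> e (i + j - 1)"
            using adj(1)[of "i + j'"] j j' y(1) old_edge(1) by (cases "j = ?n") auto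
          ultimately show "{?v (j - 1), ?v j} \<subseteq> e (i + j - 1)" by auto
        qed
      qed (use old_edge in \<open>auto intro!: eF\<close>)
      then show False using assms(1) by (auto simp: cycle_free_def)
    next
      case new
      have "trail F (Suc l) (v(l := y)) (e(Suc l := f))"
        unfolding trail_def
      proof (intro conjI)
        have "{1..Suc l} = insert (Suc l) {1..l}" by auto
        then show "inj_on (e(Suc l := f)) {1..Suc l}"
          using inj_on_fun_updI[OF inje new(2)] new(2) by (simp add: image_iff)
        have "{1..<Suc l} = insert l {1..<l}" using l by auto
        then show "inj_on (v(l := y)) {1..<Suc l}"
          using inj_on_fun_updI[OF injv new(1)] new(1) by (simp add: image_iff)
        show "(e(Suc l := f)) ` {1..Suc l} \<subseteq> F"
          using eF y(2) by (auto simp: le_Suc_eq)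
        show "\<forall>i\<in>{1..<Suc l}. (v(l := y)) i \<in> (e(Suc l := f)) i
            \<and> (v(l := y)) i \<in> (e(Suc l := f)) (Suc i)"
        proof
          fix i assume "i \<in> {1..<Suc l}"
          then consider "i = l" | "i \<in> {1..<l}" by force
          then show "(v(l := y)) i \<in> (e(Suc l := f)) i \<and> (v(l := y)) i \<in> (e(Suc l := f)) (Suc i)"
            by cases (use adj[of i] y in auto)
        qed
      qed simp
      from max[OF this] show False by simp
    qed
  qed
  then obtain e x where e: "e \<in> F" and x: "\<forall>y\<in>e. \<forall>f\<in>F. y \<in> f \<longrightarrow> f = e \<or> y = x"
    by blast
  show thesis
  proof (cases "x \<in> e")
    case True
    show thesis by (rule that[OF e True]) (use x in blast)
  next
    case False
    obtain x' where x': "x' \<in> e" using assms(4) e by (cases "e = {}") auto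
    show thesis by (rule that[OF e x']) (use x False in blast)
  qed
qed

section \<open>Rainbow colourings\<close>
definition rainbow :: "nat \<Rightarrow> 'v set set \<Rightarrow> ('v \<Rightarrow> nat) \<Rightarrow> bool" where
  "rainbow k F \<phi> \<longleftrightarrow> range \<phi> \<subseteq> {1..k} \<and> (\<forall>e\<in>F. inj_on \<phi> e)"

lemma rainbow_range: "rainbow k F \<phi> \<Longrightarrow> \<phi> v \<in> {1..k}"
  unfolding rainbow_def by blast

text \<open>The vertices of \<open>e\<close> other than \<open>x\<close> are in no other edge, so that they can be coloured
  freely with the colours different from that of \<open>x\<close>; one of these colours can be prescribed.\<close>
lemma rainbow_extend:
  assumes \<phi>: "rainbow k F \<phi>" and e: "finite e" "card e = k" "x \<in> e"
    and new: "\<forall>y\<in>e. \<forall>f\<in>F. y \<in> f \<longrightarrow> y = x"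
    and u: "u \<in> e - {x}" and c: "c \<in> {1..k} - {\<phi> x}"
  shows "\<exists>\<psi>. rainbow k (insert e F) \<psi> \<and> \<psi> u = c \<and> (\<forall>v. v \<notin> e - {x} \<longrightarrow> \<psi> v = \<phi> v)"
proof -
  have px: "\<phi> x \<in> {1..k}" using \<phi> by (rule rainbow_range)
  have "card (e - {x} - {u}) = card ({1..k} - {\<phi> x} - {c})"
    using e u c px by (simp add: card_Diff_singleton_if)
  then obtain b where b: "bij_betw b (e - {x} - {u}) ({1..k} - {\<phi> x} - {c})"
    using finite_same_card_bij e(1) by (metis finite_Diff finite_atLeastAtMost)
  define \<psi> where "\<psi> v = (if v = u then c else if v \<in> e - {x} then b v else \<phi> v)" for v
  have b_range: "b v \<in> {1..k} - {\<phi> x} - {c}" if "v \<in> e - {x} - {u}" for v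
    using b that by (auto dest: bij_betwE)
  have old: "\<psi> v = \<phi> v" if "v \<notin> e - {x}" for v using that u by (auto simp: \<psi>_def)
  have "inj_on \<psi> e"
  proof (rule inj_onI)
    fix v w assume vw: "v \<in> e" "w \<in> e" "\<psi> v = \<psi> w"
    show "v = w"
      using vw b_range[of v] b_range[of w] inj_onD[OF bij_betw_imp_inj_on[OF b], of v w] u c
      by (auto simp: \<psi>_def split: if_splits)
  qed
  moreover have "inj_on \<psi> f" if "f \<in> F" for f
  proof -
    have "inj_on \<phi> f" using \<phi> that by (auto simp: rainbow_def)
    moreover have "\<psi> v = \<phi> v" if "v \<in> f" for v using old new \<open>f \<in> F\<close> that by blast
    ultimately show ?thesis by (simp add: inj_on_def)
  qed
  moreover have "\<psi> v \<in> {1..k}" for v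
    using b_range[of v] c rainbow_range[OF \<phi>, of v] by (auto simp: \<psi>_def)
  ultimately have "rainbow k (insert e F) \<psi>" by (auto simp: rainbow_def)
  moreover have "\<psi> u = c" by (simp add: \<psi>_def)
  ultimately show ?thesis using old by blast
qed

text \<open>Both claims are proved by removing a leaf \<open>e\<close>, attached at the vertex \<open>x\<close>, and recolouring
  its other vertices. The induction needs both: to give \<open>u\<close> in \<open>e\<close> the colour of \<open>v\<close> outside \<open>e\<close>, the
  colour of \<open>v\<close> must differ from that of \<open>x\<close>. To give \<open>u\<close> a colour different from those of \<open>v\<close> and
  \<open>x\<close>, three colours are needed.\<close>
lemma cycle_free_rainbow:
  assumes "finite F" "cycle_free F" "\<And>e. e \<in> F \<Longrightarrow> finite e \<and> card e = k" "k \<ge> 3" "u \<noteq> v"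
  shows cycle_free_rainbow_distinct: "\<exists>\<phi>. rainbow k F \<phi> \<and> \<phi> u \<noteq> \<phi> v" (is ?D)
    and cycle_free_rainbow_equal:
      "(\<And>e. e \<in> F \<Longrightarrow> \<not> (u \<in> e \<and> v \<in> e)) \<Longrightarrow> \<exists>\<phi>. rainbow k F \<phi> \<and> \<phi> u = \<phi> v"
proof -
  have "(\<exists>\<phi>. rainbow k F \<phi> \<and> \<phi> u \<noteq> \<phi> v) \<and>
      ((\<forall>e\<in>F. \<not> (u \<in> e \<and> v \<in> e)) \<longrightarrow> (\<exists>\<phi>. rainbow k F \<phi> \<and> \<phi> u = \<phi> v))"
    using assms(1,2,3,5)
  proof (induction F arbitrary: u v rule: finite_psubset_induct)
    case (psubset F)
    show ?case
    proof (cases "F = {}")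
      case True
      have "rainbow k F (\<lambda>w. if w = u then 1 else 2)" "rainbow k F (\<lambda>_. 1)"
        using True \<open>k \<ge> 3\<close> by (auto simp: rainbow_def)
      moreover have "(if u = u then 1 else 2 :: nat) \<noteq> (if v = u then 1 else 2)"
        using psubset.prems(3) by auto
      ultimately show ?thesis by (intro conjI impI; blast)
    next
      case False
      have "{} \<notin> F" using psubset.prems(2) \<open>k \<ge> 3\<close> by fastforce
      then obtain e x where e: "e \<in> F" "x \<in> e"
        and leaf: "\<And>y f. y \<in> e \<Longrightarrow> f \<in> F \<Longrightarrow> y \<in> f \<Longrightarrow> f = e \<or> y = x"
        using cycle_free_leaf[OF psubset.prems(1) psubset.hyps(1) False] by metis
      define F' where "F' = F - {e}"
      have F': "F' \<subset> F" "insert e F' = F" using e by (auto simp: F'_def)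
      have ce: "finite e" "card e = k" using psubset.prems(2) e by auto
      have IH: "\<exists>\<phi>. rainbow k F' \<phi> \<and> \<phi> a \<noteq> \<phi> b"
        "(\<And>e. e \<in> F' \<Longrightarrow> \<not> (a \<in> e \<and> b \<in> e)) \<Longrightarrow> \<exists>\<phi>. rainbow k F' \<phi> \<and> \<phi> a = \<phi> b"
        if "a \<noteq> b" for a b
        using psubset.IH[OF F'(1) cycle_free_subset[OF psubset.prems(1)] psubset.prems(2) that]
          F'(1) by blast+
      have extend: "\<exists>\<psi>. rainbow k F \<psi> \<and> \<psi> a = c \<and> (\<forall>b. b \<notin> e - {x} \<longrightarrow> \<psi> b = \<phi> b)"
        if prm: "rainbow k F' \<phi>" "a \<in> e - {x}" "c \<in> {1..k} - {\<phi> x}" for \<phi> a c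
      proof -
        have new: "\<forall>y\<in>e. \<forall>f\<in>F'. y \<in> f \<longrightarrow> y = x"
          using leaf by (auto simp: F'_def)
        show ?thesis
          using rainbow_extend[OF prm(1) ce e(2) new prm(2,3)] unfolding F'(2) by blast
      qed
      have extend': "\<exists>\<psi>. rainbow k F \<psi> \<and> (\<forall>b. b \<notin> e - {x} \<longrightarrow> \<psi> b = \<phi> b)"
        if "rainbow k F' \<phi>" for \<phi>
      proof -
        have "e - {x} \<noteq> {}"
        proof
          assume "e - {x} = {}"
          then have "card e \<le> card {x}" by (intro card_mono) auto
          then show False using ce \<open>k \<ge> 3\<close> by simp
        qed
        moreover have "(if \<phi> x = 1 then 2 else 1) \<in> {1..k} - {\<phi> x}" using \<open>k \<ge> 3\<close> by auto
        ultimately show ?thesis using extend[OF that] by blast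
      qed
      have inner: "\<phi> a \<noteq> \<phi> b" if "rainbow k F \<phi>" "a \<in> e" "b \<in> e" "a \<noteq> b" for \<phi> a b
        using that e by (auto simp: rainbow_def dest: inj_onD)
      have mixed: "(\<exists>\<phi>. rainbow k F \<phi> \<and> \<phi> a \<noteq> \<phi> b) \<and>
          ((\<forall>f\<in>F. \<not> (a \<in> f \<and> b \<in> f)) \<longrightarrow> (\<exists>\<phi>. rainbow k F \<phi> \<and> \<phi> a = \<phi> b))"
        if a: "a \<in> e - {x}" and b: "b \<notin> e - {x}" for a b
      proof (cases "b = x")
        case True
        obtain \<phi> where "rainbow k F \<phi>" using IH(1)[of a b] extend' a b by blast
        then show ?thesis using inner[of \<phi> a b] True a e by blast
      next
        case False
        then obtain \<phi> where \<phi>: "rainbow k F' \<phi>" "\<phi> b \<noteq> \<phi> x" using IH(1)[of b x] by blast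
        have 1: "\<phi> b \<in> {1..k} - {\<phi> x}" using rainbow_range[OF \<phi>(1)] \<phi>(2) by blast
        obtain c where c: "c \<in> {1..k} - {\<phi> x}" "c \<noteq> \<phi> b"
        proof -
          have "card {\<phi> x, \<phi> b} < card {1..k}" using \<open>k \<ge> 3\<close> by (simp add: card_insert_if)
          then have "\<not> {1..k} \<subseteq> {\<phi> x, \<phi> b}" by (meson card_mono finite.intros leD)
          then show thesis using that by blast
        qed
        obtain \<psi> where \<psi>: "rainbow k F \<psi>" "\<psi> a = \<phi> b" "\<psi> b = \<phi> b"
          using extend[OF \<phi>(1) a 1] b by blast
        obtain \<psi>' where \<psi>': "rainbow k F \<psi>'" "\<psi>' a = c" "\<psi>' b = \<phi> b"
          using extend[OF \<phi>(1) a c(1)] b by blast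
        have "\<psi>' a \<noteq> \<psi>' b" "\<psi> a = \<psi> b" using \<psi> \<psi>' c(2) by auto
        with \<psi>(1) \<psi>'(1) show ?thesis by blast
      qed
      consider (both) "u \<in> e - {x}" "v \<in> e - {x}" | (left) "u \<in> e - {x}" "v \<notin> e - {x}"
        | (right) "u \<notin> e - {x}" "v \<in> e - {x}" | (none) "u \<notin> e - {x}" "v \<notin> e - {x}" by blast
      then show ?thesis
      proof cases
        case both
        obtain \<phi> where "rainbow k F \<phi>" using IH(1)[OF psubset.prems(3)] extend' by blast
        then show ?thesis using inner[of \<phi> u v] both e psubset.prems(3) by blast
      next
        case left
        then show ?thesis by (rule mixed)
      next
        case right
        then show ?thesis using mixed[OF right(2,1)] by (simp add: conj_commute eq_commute)
      next
        case none
        obtain \<phi> where \<phi>: "rainbow k F' \<phi>" "\<phi> u \<noteq> \<phi> v" using IH(1)[OF psubset.prems(3)] by blast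
        obtain \<psi> where "rainbow k F \<psi>" "\<psi> u = \<phi> u" "\<psi> v = \<phi> v"
          using extend'[OF \<phi>(1)] none by blast
        with \<phi>(2) have "\<exists>\<phi>. rainbow k F \<phi> \<and> \<phi> u \<noteq> \<phi> v" by auto
        moreover have "\<exists>\<phi>. rainbow k F \<phi> \<and> \<phi> u = \<phi> v" if sep: "\<forall>e\<in>F. \<not> (u \<in> e \<and> v \<in> e)"
        proof -
          obtain \<phi> where \<phi>: "rainbow k F' \<phi>" "\<phi> u = \<phi> v"
            using IH(2)[OF psubset.prems(3)] sep F'(1) by blast
          obtain \<psi> where "rainbow k F \<psi>" "\<psi> u = \<phi> u" "\<psi> v = \<phi> v"
            using extend'[OF \<phi>(1)] none by blast
          with \<phi>(2) show ?thesis by auto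
        qed
        ultimately show ?thesis by blast
      qed
    qed
  qed
  then show ?D "(\<And>e. e \<in> F \<Longrightarrow> \<not> (u \<in> e \<and> v \<in> e)) \<Longrightarrow> \<exists>\<phi>. rainbow k F \<phi> \<and> \<phi> u = \<phi> v"
    by blast+
qed

lemma cycle_free_common_vertices:
  assumes "cycle_free F" "e \<in> F" "f \<in> F" "u \<in> e" "v \<in> e" "u \<in> f" "v \<in> f" "u \<noteq> v"
  shows "e = f"
proof (rule ccontr)
  assume "e \<noteq> f"
  then have "is_cycle (UNIV, F) 2 (\<lambda>i. if i = 1 then v else u) (\<lambda>i. if i = 1 then e else f)"
    using assms by (auto simp: is_cycle_def inj_on_def numeral_2_eq_2 less_Suc_eq le_Suc_eq)
  then show False using assms(1) by (auto simp: cycle_free_def)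
qed

lemma cycle_free_triangle:
  assumes F: "cycle_free F" "e \<in> F" "f \<in> F" "g \<in> F"
    and mem: "u \<in> e" "v \<in> e" "v \<in> f" "w \<in> f" "w \<in> g" "u \<in> g"
    and ne: "u \<noteq> v" "v \<noteq> w" "u \<noteq> w"
  shows "w \<in> e"
proof (cases "e = f \<or> f = g \<or> e = g")
  case True
  then show ?thesis using mem cycle_free_common_vertices[OF F(1,2,3) mem(1,2)] ne by auto
next
  case False
  then have "is_cycle (UNIV, F) 3
      (\<lambda>i. if i = 1 then v else if i = 2 then w else u) (\<lambda>i. if i = 1 then e else if i = 2 then f else g)"
    using assms by (auto simp: is_cycle_def inj_on_def numeral_3_eq_3 numeral_2_eq_2 less_Suc_eq le_Suc_eq)
  then show ?thesis using F(1) by (auto simp: cycle_free_def)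
qed

text \<open>Any two vertices of \<open>K\<close> are adjacent since otherwise some colouring would identify them.
  The edge through two of them contains every third one, as there are no triangles.\<close>
lemma always_rainbow_imp_edge:
  assumes F: "finite F" "cycle_free F" "\<And>e. e \<in> F \<Longrightarrow> finite e \<and> card e = k" and "k \<ge> 3"
    and K: "finite K" "card K = k" "\<And>\<phi>. rainbow k F \<phi> \<Longrightarrow> inj_on \<phi> K"
  shows "K \<in> F"
proof -
  have adj: "\<exists>e\<in>F. u \<in> e \<and> v \<in> e" if "u \<in> K" "v \<in> K" "u \<noteq> v" for u v
    using cycle_free_rainbow_equal[OF F \<open>k \<ge> 3\<close> \<open>u \<noteq> v\<close>] K(3) that by (metis inj_onD)
  obtain u v where uv: "u \<in> K" "v \<in> K" "u \<noteq> v"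
    using K(2) \<open>k \<ge> 3\<close> by (metis card_le_Suc0_iff_eq K(1) Suc_n_not_le_n le_trans numeral_3_eq_3 le_SucI)
  then obtain e where e: "e \<in> F" "u \<in> e" "v \<in> e" using adj by blast
  have "w \<in> e" if wK: "w \<in> K" for w
  proof (cases "w = u \<or> w = v")
    case False
    then obtain f g where "f \<in> F" "v \<in> f" "w \<in> f" "g \<in> F" "w \<in> g" "u \<in> g"
      using adj[of v w] adj[of u w] uv wK by blast
    with False e uv(3) show ?thesis using cycle_free_triangle[OF F(2), of e f g u v w] by blast
  qed (use e in auto)
  then have "K = e" using F(3)[OF e(1)] K by (metis card_subset_eq subsetI)
  then show ?thesis using e by simp
qed

section \<open>Languages of terms\<close>
definition sumset :: "'l multiset set \<Rightarrow> 'l multiset set \<Rightarrow> 'l multiset set" where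
  "sumset X Y = {M + N | M N. M \<in> X \<and> N \<in> Y}"

text \<open>The set of commutative words that arises from a term when a set of commutative words is
  substituted for each variable.\<close>
primrec lang :: "('x \<Rightarrow> 'l multiset set) \<Rightarrow> 'x ai_term \<Rightarrow> 'l multiset set" where
  "lang X (Var x) = X x"
| "lang X (Plus s t) = lang X s \<union> lang X t"
| "lang X (Times s t) = sumset (lang X s) (lang X t)"

definition words :: "'x ai_term \<Rightarrow> 'x multiset set" where
  "words = lang (\<lambda>x. {{#x#}})"

lemma words_simps [simp]:
  "words (Var x) = {{#x#}}"
  "words (Plus s t) = words s \<union> words t"
  "words (Times s t) = sumset (words s) (words t)"
  by (simp_all add: words_def)

lemma sumset_eq_image: "sumset X Y = (\<lambda>(M, N). M + N) ` (X \<times> Y)"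
  by (auto simp: sumset_def)

lemma finite_words: "finite (words t)"
  by (induction t) (auto simp: sumset_eq_image)

lemma words_nonempty: "words t \<noteq> {}"
  by (induction t) (auto simp: sumset_eq_image)

text \<open>Different occurrences of a variable \<open>x\<close> in a word of \<open>t\<close> may be replaced by different members
  of \<open>X x\<close>. The multiset \<open>R\<close> pairs each occurrence with its replacement.\<close>
lemma lang_eq_words:
  "lang X t = {\<Sum>\<^sub># (image_mset snd R) | R.
    image_mset fst R \<in> words t \<and> (\<forall>(x, M) \<in># R. M \<in> X x)}"
proof (induction t)
  case (Var x)
  have "\<exists>R. M = \<Sum>\<^sub># (image_mset snd R) \<and> image_mset fst R = {#x#} \<and> (\<forall>(x, M) \<in># R. M \<in> X x)"
    if "M \<in> X x" for M
    using that by (intro exI[of _ "{#(x, M)#}"]) auto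
  moreover have "\<Sum>\<^sub># (image_mset snd R) \<in> X x"
    if "image_mset fst R = {#x#}" "\<forall>(x, M) \<in># R. M \<in> X x" for R
  proof -
    have "size R = 1" using arg_cong[OF that(1), of size] by simp
    then obtain z where "R = {#z#}" using size_1_singleton_mset by blast
    then show ?thesis using that by (cases z) auto
  qed
  ultimately show ?case unfolding lang.simps words_simps by blast
next
  case (Plus s t)
  then show ?case unfolding lang.simps words_simps by blast
next
  case (Times s t)
  let ?Q = "\<lambda>t R. image_mset fst R \<in> words t \<and> (\<forall>(x, M) \<in># R. M \<in> X x)"
  have 1: "\<exists>R. L = \<Sum>\<^sub># (image_mset snd R) \<and> ?Q (Times s t) R"
    if L: "L \<in> sumset (lang X s) (lang X t)" for L
  proof -
    from L obtain M N where MN: "L = M + N" "M \<in> lang X s" "N \<in> lang X t"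
      by (auto simp: sumset_def)
    with Times obtain R1 R2 where "M = \<Sum>\<^sub># (image_mset snd R1)" "?Q s R1"
      "N = \<Sum>\<^sub># (image_mset snd R2)" "?Q t R2" by blast
    then show ?thesis by (intro exI[of _ "R1 + R2"]) (auto simp: sumset_def MN(1))
  qed
  have 2: "\<Sum>\<^sub># (image_mset snd R) \<in> sumset (lang X s) (lang X t)" if "?Q (Times s t) R" for R
  proof -
    from that obtain w1 w2 where "image_mset fst R = w1 + w2" "w1 \<in> words s" "w2 \<in> words t"
      by (auto simp: sumset_def)
    then obtain R1 R2 where R': "R = R1 + R2" "w1 = image_mset fst R1" "w2 = image_mset fst R2"
      by (metis image_mset_eq_plusD)
    have "\<Sum>\<^sub># (image_mset snd R1) \<in> lang X s" "\<Sum>\<^sub># (image_mset snd R2) \<in> lang X t"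
      unfolding Times.IH using that R' \<open>w1 \<in> words s\<close> \<open>w2 \<in> words t\<close> by auto
    then show ?thesis by (auto simp: sumset_def R'(1))
  qed
  show ?case
  proof (intro equalityI subsetI)
    fix L assume "L \<in> lang X (Times s t)"
    then have "L \<in> sumset (lang X s) (lang X t)" by simp
    from 1[OF this] show "L \<in> {\<Sum>\<^sub># (image_mset snd R) | R. ?Q (Times s t) R}"
      by (elim exE) (rule CollectI, rule exI, assumption)
  next
    fix L assume "L \<in> {\<Sum>\<^sub># (image_mset snd R) | R. ?Q (Times s t) R}"
    then obtain R where "L = \<Sum>\<^sub># (image_mset snd R)" "?Q (Times s t) R" by (elim CollectE exE conjE) simp
    then show "L \<in> lang X (Times s t)" using 2 by simp
  qed
qed

lemma langI:
  assumes "image_mset fst R \<in> words t" "\<And>x Q. (x, Q) \<in># R \<Longrightarrow> Q \<in> X x"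
  shows "\<Sum>\<^sub># (image_mset snd R) \<in> lang X t"
proof -
  have "\<forall>(x, Q) \<in># R. Q \<in> X x" using assms(2) by auto
  with assms(1) show ?thesis unfolding lang_eq_words by (intro CollectI exI[of _ R] conjI refl)
qed

lemma choice_in_lang:
  assumes "w \<in> words t" "\<And>x. x \<in># w \<Longrightarrow> M x \<in> X x"
  shows "(\<Sum>x\<in>#w. M x) \<in> lang X t"
proof -
  let ?R = "image_mset (\<lambda>x. (x, M x)) w"
  have "\<Sum>\<^sub># (image_mset snd ?R) \<in> lang X t"
    by (rule langI) (use assms in \<open>auto simp: multiset.map_comp comp_def\<close>)
  then show ?thesis by (simp add: multiset.map_comp comp_def)
qed

lemma choice_in_lang_change:
  assumes "w \<in> words t" "x \<in># w" "\<And>y. y \<in># w \<Longrightarrow> M y \<in> X y" "Q \<in> X x"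
  shows "Q + (\<Sum>y\<in>#w - {#x#}. M y) \<in> lang X t"
proof -
  let ?R = "add_mset (x, Q) (image_mset (\<lambda>x. (x, M x)) (w - {#x#}))"
  have "\<Sum>\<^sub># (image_mset snd ?R) \<in> lang X t"
  proof (rule langI)
    show "image_mset fst ?R \<in> words t" using assms(1,2) by (simp add: multiset.map_comp comp_def)
    fix y P assume "(y, P) \<in># ?R"
    then consider "y = x" "P = Q" | "y \<in># w - {#x#}" "P = M y" by auto
    then show "P \<in> X y"
    proof cases
      case 2
      then show ?thesis using assms(3) in_diffD[OF 2(1)] by simp
    qed (use assms(4) in simp)
  qed
  then show ?thesis by (simp add: multiset.map_comp comp_def)
qed

section \<open>The syntactic ai-semiring of a commutative language\<close>
definition contexts :: "'l multiset set \<Rightarrow> 'l multiset set \<Rightarrow> 'l multiset set" where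
  "contexts L X = {P. \<forall>M\<in>X. M + P \<in> L}"

text \<open>A class of the syntactic congruence is represented by its set of contexts. By the symmetry of
  the relation \<open>M + P \<in> L\<close>, \<open>contexts L (contexts L X)\<close> is the largest set with the same contexts as
  \<open>X\<close>; the product is computed with these largest sets. The empty word is excluded from \<open>X\<close> because the
  semiring must not acquire a multiplicative identity: \<open>S\<^sub>c(W)\<close> satisfies identities that express
  that long products are zero.\<close>
definition syntactic :: "'l multiset set \<Rightarrow> 'l multiset set ai_alg" where
  "syntactic L =
    \<lparr> elems = {contexts L X | X. X \<noteq> {} \<and> {#} \<notin> X},
      add = (\<inter>),
      mul = (\<lambda>c d. contexts L (sumset (contexts L c) (contexts L d))) \<rparr>"

lemma contextsI: "(\<And>M. M \<in> X \<Longrightarrow> M + P \<in> L) \<Longrightarrow> P \<in> contexts L X"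
  by (simp add: contexts_def)

lemma contextsD: "P \<in> contexts L X \<Longrightarrow> M \<in> X \<Longrightarrow> M + P \<in> L"
  by (simp add: contexts_def)

lemma subset_contexts_contexts: "X \<subseteq> contexts L (contexts L X)"
  by (auto intro!: contextsI dest: contextsD simp: add.commute)

lemma sumset_mono: "X \<subseteq> X' \<Longrightarrow> Y \<subseteq> Y' \<Longrightarrow> sumset X Y \<subseteq> sumset X' Y'"
  unfolding sumset_def by blast

text \<open>The product of two classes does not depend on the representatives \<open>X\<close> and \<open>Y\<close>.\<close>
lemma contexts_sumset:
  "contexts L (sumset (contexts L (contexts L X)) (contexts L (contexts L Y)))
    = contexts L (sumset X Y)"
proof (intro equalityI subsetI)
  fix P
  assume "P \<in> contexts L (sumset (contexts L (contexts L X)) (contexts L (contexts L Y)))"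
  from contextsD[OF this] show "P \<in> contexts L (sumset X Y)"
    by (intro contextsI)
      (meson subsetD sumset_mono[OF subset_contexts_contexts subset_contexts_contexts])
next
  fix P assume P: "P \<in> contexts L (sumset X Y)"
  show "P \<in> contexts L (sumset (contexts L (contexts L X)) (contexts L (contexts L Y)))"
  proof (rule contextsI)
    fix Z assume "Z \<in> sumset (contexts L (contexts L X)) (contexts L (contexts L Y))"
    then obtain M N where Z: "Z = M + N"
      and M: "M \<in> contexts L (contexts L X)" and N: "N \<in> contexts L (contexts L Y)"
      by (auto simp: sumset_def)
    have "P + M \<in> contexts L Y"
    proof (rule contextsI)
      fix N' assume N': "N' \<in> Y"
      have "N' + P \<in> contexts L X"
      proof (rule contextsI)
        fix M' assume "M' \<in> X"
        then have "M' + N' \<in> sumset X Y" using N' by (auto simp: sumset_def)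
        from contextsD[OF P this] show "M' + (N' + P) \<in> L" by (simp add: add.assoc)
      qed
      from contextsD[OF M this] show "N' + (P + M) \<in> L" by (simp add: add.assoc)
    qed
    from contextsD[OF N this] show "Z + P \<in> L" by (simp add: Z ac_simps)
  qed
qed

lemma add_syntactic: "add (syntactic L) (contexts L X) (contexts L Y) = contexts L (X \<union> Y)"
  by (auto simp: syntactic_def contexts_def)

lemma mul_syntactic: "mul (syntactic L) (contexts L X) (contexts L Y) = contexts L (sumset X Y)"
  by (simp add: syntactic_def contexts_sumset)

lemma eval_syntactic: "eval (syntactic L) (\<lambda>x. contexts L (X x)) t = contexts L (lang X t)"
  by (induction t) (simp_all add: add_syntactic mul_syntactic)

lemma in_elems_syntactic:
  "c \<in> elems (syntactic L) \<longleftrightarrow> (\<exists>X. c = contexts L X \<and> X \<noteq> {} \<and> {#} \<notin> X)"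
  by (auto simp: syntactic_def)

lemma sumset_assoc: "sumset (sumset X Y) Z = sumset X (sumset Y Z)"
proof -
  have "sumset (sumset X Y) Z = {M + N + P | M N P. M \<in> X \<and> N \<in> Y \<and> P \<in> Z}"
    unfolding sumset_def by blast
  moreover have "sumset X (sumset Y Z) = {M + (N + P) | M N P. M \<in> X \<and> N \<in> Y \<and> P \<in> Z}"
    unfolding sumset_def by blast
  ultimately show ?thesis by (simp add: add.assoc)
qed

lemma sumset_Un:
  "sumset X (Y \<union> Z) = sumset X Y \<union> sumset X Z"
  "sumset (X \<union> Y) Z = sumset X Z \<union> sumset Y Z"
  unfolding sumset_def by blast+

lemma ai_semiring_syntactic: "ai_semiring (syntactic L)"
proof
  have "contexts L {{#undefined#}} \<in> elems (syntactic L)"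
    unfolding in_elems_syntactic by (intro exI[of _ "{{#undefined#}}"]) simp
  then show "elems (syntactic L) \<noteq> {}" by blast
next
  fix x y assume "x \<in> elems (syntactic L)" "y \<in> elems (syntactic L)"
  then obtain X Y where x: "x = contexts L X" "X \<noteq> {}" "{#} \<notin> X"
    and y: "y = contexts L Y" "Y \<noteq> {}" "{#} \<notin> Y" unfolding in_elems_syntactic by blast
  have "X \<union> Y \<noteq> {}" "{#} \<notin> X \<union> Y" "sumset X Y \<noteq> {}" "{#} \<notin> sumset X Y"
    using x y by (auto simp: sumset_eq_image)
  then show "add (syntactic L) x y \<in> elems (syntactic L)" "mul (syntactic L) x y \<in> elems (syntactic L)"
    unfolding in_elems_syntactic x(1) y(1) add_syntactic mul_syntactic by blast+
qed (clarsimp simp: in_elems_syntactic add_syntactic mul_syntactic Un_ac sumset_assoc sumset_Un)+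

lemma satisfies_syntacticI:
  fixes s t :: "'x ai_term" and L :: "'l multiset set"
  assumes "\<And>(X :: 'x \<Rightarrow> 'l multiset set) P. (\<And>x. X x \<noteq> {}) \<Longrightarrow> (\<And>x. {#} \<notin> X x) \<Longrightarrow>
    P \<in> contexts L (lang X s) \<longleftrightarrow> P \<in> contexts L (lang X t)"
  shows "satisfies (syntactic L) (s, t)"
  unfolding satisfies_def prod.case
proof (intro allI impI)
  fix f :: "'x \<Rightarrow> 'l multiset set" assume "range f \<subseteq> elems (syntactic L)"
  then have "\<forall>x. \<exists>X. f x = contexts L X \<and> X \<noteq> {} \<and> {#} \<notin> X"
    unfolding in_elems_syntactic[symmetric] by blast
  then obtain X where X: "\<And>x. f x = contexts L (X x)" "\<And>x. X x \<noteq> {}" "\<And>x. {#} \<notin> X x"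
    by metis
  have "f = (\<lambda>x. contexts L (X x))" using X(1) by auto
  moreover have "contexts L (lang X s) = contexts L (lang X t)" by (intro set_eqI assms) (use X in auto)
  ultimately show "eval (syntactic L) f s = eval (syntactic L) f t" by (simp add: eval_syntactic)
qed

section \<open>Values of terms in \<open>S\<^sub>c(W)\<close>\<close>
lemma add_S_c_eq_Some: "add (S_c W) a b = Some U \<longleftrightarrow> a = Some U \<and> b = Some U"
  by (auto simp: S_c_def)

lemma mul_S_c_eq_Some:
  "mul (S_c W) a b = Some U \<longleftrightarrow> (\<exists>M N. a = Some M \<and> b = Some N \<and> M + N = U \<and> U \<subseteq># W)"
  by (auto simp: S_c_def split: option.splits)

text \<open>The sum of two different elements is zero, so that a term has a nonzero value exactly if
  all its words have this value.\<close>
lemma eval_S_c_eq_Some: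
  assumes "range g \<subseteq> elems (S_c W)"
  shows "eval (S_c W) g t = Some U \<longleftrightarrow>
    U \<subseteq># W \<and> (\<forall>w\<in>words t. (\<forall>x\<in>#w. g x \<noteq> None) \<and> (\<Sum>x\<in>#w. the (g x)) = U)"
proof (induction t arbitrary: U)
  case (Var x)
  have "g x \<in> elems (S_c W)" using assms by auto
  then show ?case by (auto simp: S_c_def)
next
  case (Plus s t)
  then show ?case by (auto simp: add_S_c_eq_Some)
next
  case (Times s t)
  let ?v = "\<lambda>w. \<Sum>x\<in>#w. the (g x)"
  show ?case
  proof
    assume "eval (S_c W) g (Times s t) = Some U"
    then show "U \<subseteq># W \<and> (\<forall>w\<in>words (Times s t). (\<forall>x\<in>#w. g x \<noteq> None) \<and> ?v w = U)"
      using Times by (fastforce simp: mul_S_c_eq_Some sumset_def)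
  next
    assume R: "U \<subseteq># W \<and> (\<forall>w\<in>words (Times s t). (\<forall>x\<in>#w. g x \<noteq> None) \<and> ?v w = U)"
    obtain w1 w2 where w: "w1 \<in> words s" "w2 \<in> words t" using words_nonempty by blast
    have *: "(\<forall>x\<in>#a + b. g x \<noteq> None) \<and> ?v a + ?v b = U" if "a \<in> words s" "b \<in> words t" for a b
      using R that by (fastforce simp: sumset_def)
    have sub: "?v w1 \<subseteq># W" "?v w2 \<subseteq># W"
      using *[OF w] R by (metis mset_subset_eq_add_left mset_subset_eq_add_right subset_mset.order_trans)+
    have "eval (S_c W) g s = Some (?v w1)"
      unfolding Times.IH(1)
    proof (intro conjI ballI sub)
      fix a assume a: "a \<in> words s"
      show "?v a = ?v w1" using *[OF a w(2)] *[OF w] by (metis add_right_cancel)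
      show "g x \<noteq> None" if "x \<in># a" for x using *[OF a w(2)] that by auto
    qed
    moreover have "eval (S_c W) g t = Some (?v w2)"
      unfolding Times.IH(2)
    proof (intro conjI ballI sub)
      fix a assume a: "a \<in> words t"
      show "?v a = ?v w2" using *[OF w(1) a] *[OF w] by (metis add_left_cancel)
      show "g x \<noteq> None" if "x \<in># a" for x using *[OF w(1) a] that by auto
    qed
    ultimately show "eval (S_c W) g (Times s t) = Some U"
      using *[OF w] R by (auto simp: mul_S_c_eq_Some)
  qed
qed

lemma image_mset_eq_mset_setD:
  assumes "image_mset \<phi> Z = mset_set C" "finite C"
  shows "Z = mset_set (set_mset Z)" "inj_on \<phi> (set_mset Z)" "card (set_mset Z) = card C"
proof -
  have C: "\<phi> ` set_mset Z = C" "size Z = card C"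
    using arg_cong[OF assms(1), of set_mset] arg_cong[OF assms(1), of size] assms(2) by auto
  have sub: "mset_set (set_mset Z) \<subseteq># Z" by (rule mset_set_set_mset_msubset)
  have "card C \<le> card (set_mset Z)" using C(1) card_image_le by (metis finite_set_mset)
  moreover have "card (set_mset Z) \<le> size Z" using size_mset_mono[OF sub] by simp
  ultimately show card: "card (set_mset Z) = card C" using C(2) by simp
  show "inj_on \<phi> (set_mset Z)" using card C(1) by (simp add: eq_card_imp_inj_on)
  show "Z = mset_set (set_mset Z)"
    using sub card C(2) by (metis mset_subset_size size_mset_set subset_mset.le_imp_less_or_eq nat_neq_iff)
qed

section \<open>Identities that hold in the syntactic ai-semiring of the edges\<close>
lemma rainbow_image_edge:
  assumes "rainbow k F \<phi>" "e \<in> F" "finite e" "card e = k"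
  shows "image_mset \<phi> (mset_set e) = mset_set {1..k}"
proof -
  have "inj_on \<phi> e" "\<phi> ` e \<subseteq> {1..k}" using assms by (auto simp: rainbow_def)
  then have "\<phi> ` e = {1..k}" using assms(4) by (simp add: card_image card_subset_eq)
  then show ?thesis using \<open>inj_on \<phi> e\<close> by (simp add: image_mset_mset_set)
qed


text \<open>A rainbow colouring \<open>\<phi>\<close> of sufficiently many edges, namely those in \<open>F\<close>, assigns to \<open>x\<close> the
  colours of an arbitrary representative \<open>M x\<close> of \<open>X x\<close>. Every other \<open>Q \<in> X x\<close> that is used has the
  same colours, because \<open>Q\<close> and \<open>M x\<close> are completed to an edge by the same vertices. Then \<open>s\<close> has the
  value complementary to the colours of \<open>P\<close>, and so has \<open>t\<close>. Variables that do not occur in \<open>s\<close> are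
  assigned \<open>0\<close>, so that they cannot occur in \<open>t\<close> either.\<close>
lemma contexts_transfer:
  fixes X :: "'x \<Rightarrow> 'v multiset set"
  assumes sat: "satisfies (S_c (mset_set {1..k})) (s, t)" and "k \<ge> 3"
    and H: "hypergraph (V, E)" "uniform k (V, E)"
    and size: "\<And>w. w \<in> words t \<Longrightarrow> enat (card (words s) + size w) < girth (V, E)"
    and X: "\<And>x. X x \<noteq> {}" "\<And>x. {#} \<notin> X x"
    and P: "P \<in> contexts (mset_set ` E) (lang X s)"
  shows "P \<in> contexts (mset_set ` E) (lang X t)"
  unfolding contexts_def
proof (intro CollectI ballI)
  fix N assume "N \<in> lang X t"
  then obtain R where N: "N = \<Sum>\<^sub># (image_mset snd R)"
    and R: "image_mset fst R \<in> words t" "\<And>x Q. (x, Q) \<in># R \<Longrightarrow> Q \<in> X x"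
    unfolding lang_eq_words by blast
  define M where "M x = (SOME Q. Q \<in> X x)" for x
  have M: "M x \<in> X x" for x unfolding M_def using X(1) some_in_eq by blast
  define occ where "occ = (\<Union>w\<in>words s. set_mset w)"
  have "\<forall>x\<in>occ. \<exists>w\<in>words s. x \<in># w" by (auto simp: occ_def)
  then obtain c where c: "\<And>x. x \<in> occ \<Longrightarrow> c x \<in> words s \<and> x \<in># c x" by metis
  \<comment> \<open>\<open>F1\<close> holds the edges that arise from the words of \<open>s\<close> through the representatives; \<open>F2\<close> holds,
    for each factor \<open>Q\<close> of \<open>N\<close>, one edge in which \<open>Q\<close> replaces a representative.\<close>
  define F1 where "F1 = (\<lambda>w. set_mset ((\<Sum>x\<in>#w. M x) + P)) ` words s"
  define F2 where "F2 = (\<lambda>(x, Q). set_mset ((Q + (\<Sum>y\<in>#c x - {#x#}. M y)) + P)) `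
    {z. z \<in># R \<and> fst z \<in> occ}"
  define F where "F = F1 \<union> F2"
  have uni: "finite e \<and> card e = k" if "e \<in> E" for e using H(2) that by (auto simp: uniform_def)
  have edge: "set_mset (Z + P) \<in> E \<and> Z + P = mset_set (set_mset (Z + P))"
    if Z: "Z \<in> lang X s" for Z
  proof -
    obtain e where e: "e \<in> E" "Z + P = mset_set e" using contextsD[OF P Z] by blast
    then have "set_mset (Z + P) = e" using uni by simp
    then show ?thesis using e by simp
  qed
  have lang1: "(\<Sum>x\<in>#w. M x) \<in> lang X s" if "w \<in> words s" for w
    using that M by (rule choice_in_lang)
  have lang2: "Q + (\<Sum>y\<in>#c x - {#x#}. M y) \<in> lang X s" if "x \<in> occ" "Q \<in> X x" for x Q
    using c[OF that(1)] M that(2) by (blast intro: choice_in_lang_change)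
  have F1_I: "set_mset ((\<Sum>x\<in>#w. M x) + P) \<in> F" if "w \<in> words s" for w
    unfolding F_def F1_def using that by blast
  have F2_I: "set_mset ((Q + (\<Sum>y\<in>#c x - {#x#}. M y)) + P) \<in> F" if "x \<in> occ" "(x, Q) \<in># R" for x Q
    unfolding F_def F2_def using that by (intro UnI2 image_eqI[of _ _ "(x, Q)"]) auto
  have "F1 \<subseteq> E" unfolding F1_def using edge lang1 by blast
  moreover have "F2 \<subseteq> E"
  proof
    fix e assume "e \<in> F2"
    then obtain x Q where "x \<in> occ" "(x, Q) \<in># R"
      "e = set_mset ((Q + (\<Sum>y\<in>#c x - {#x#}. M y)) + P)" by (auto simp: F2_def)
    then show "e \<in> E" using edge[OF lang2[OF _ R(2)]] by blast
  qed
  ultimately have FE: "F \<subseteq> E" by (simp add: F_def)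
  have "finite F" by (simp add: F_def F1_def F2_def finite_words)
  have "card F1 \<le> card (words s)" unfolding F1_def by (rule card_image_le[OF finite_words])
  moreover have "card F2 \<le> size (image_mset fst R)"
  proof -
    have "card F2 \<le> card {z. z \<in># R \<and> fst z \<in> occ}" unfolding F2_def by (rule card_image_le) simp
    also have "\<dots> \<le> card (set_mset R)" by (rule card_mono) auto
    also have "\<dots> \<le> size R" using size_mset_mono[OF mset_set_set_mset_msubset[of R]] by simp
    finally show ?thesis by simp
  qed
  ultimately have "card F \<le> card (words s) + size (image_mset fst R)"
    using card_Un_le[of F1 F2] unfolding F_def by linarith
  then have "enat (card F) < girth (V, E)"
    using size[OF R(1)] by (meson enat_ord_simps(1) order_le_less_trans)
  then have cf: "cycle_free F" using cycle_free_if_card_less_girth[OF H(1) FE \<open>finite F\<close>] by blast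
  have col: "image_mset \<phi> (N + P) = mset_set {1..k}" if \<phi>: "rainbow k F \<phi>" for \<phi>
  proof -
    let ?W = "mset_set {1..k}"
    have full: "image_mset \<phi> (Z + P) = ?W" if "Z \<in> lang X s" "set_mset (Z + P) \<in> F" for Z
      using rainbow_image_edge[OF \<phi> that(2)] edge[OF that(1)] uni by metis
    have full1: "image_mset \<phi> ((\<Sum>x\<in>#w. M x) + P) = ?W" if "w \<in> words s" for w
      using full[OF lang1 F1_I] that by blast
    obtain w0 where w0: "w0 \<in> words s" using words_nonempty by blast
    \<comment> \<open>The value of \<open>s\<close>: the colours that are missing in \<open>P\<close>. All words of \<open>s\<close> give the same \<open>U\<close>.\<close>
    define U where "U = image_mset \<phi> (\<Sum>x\<in>#w0. M x)"
    have UP: "U + image_mset \<phi> P = ?W" using full1[OF w0] by (simp add: U_def)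
    have UW: "U \<subseteq># ?W" by (metis UP mset_subset_eq_add_left)
    define g where "g x = (if x \<in> occ then Some (image_mset \<phi> (M x)) else None)" for x
    have split: "M x + (\<Sum>y\<in>#c x - {#x#}. M y) = (\<Sum>y\<in>#c x. M y)" if "x \<in> occ" for x
    proof -
      have "c x = add_mset x (c x - {#x#})" using c[OF that] by simp
      then have "(\<Sum>y\<in>#c x. M y) = (\<Sum>y\<in>#add_mset x (c x - {#x#}). M y)" by (rule arg_cong)
      then show ?thesis by simp
    qed
    have range_g: "range g \<subseteq> elems (S_c ?W)"
    proof -
      have "image_mset \<phi> (M x) \<subseteq># ?W" if "x \<in> occ" for x
      proof -
        have "?W = image_mset \<phi> (M x + (\<Sum>y\<in>#c x - {#x#}. M y) + P)"
          using full1[of "c x"] c[OF that] unfolding split[OF that] by simp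
        also have "\<dots> = image_mset \<phi> (M x) + image_mset \<phi> ((\<Sum>y\<in>#c x - {#x#}. M y) + P)" by simp
        finally show ?thesis by (metis mset_subset_eq_add_left)
      qed
      moreover have "M x \<noteq> {#}" for x using X(2) M by metis
      ultimately show ?thesis by (auto simp: g_def S_c_def)
    qed
    note ev = eval_S_c_eq_Some[OF this]
    have g_sum: "(\<Sum>x\<in>#w. the (g x)) = image_mset \<phi> (\<Sum>x\<in>#w. M x)" if "\<forall>x\<in>#w. x \<in> occ" for w
      using that by (induction w) (auto simp: g_def)
    have "eval (S_c ?W) g s = Some U"
      unfolding ev
    proof (intro conjI ballI UW)
      fix w assume w: "w \<in> words s"
      then have o: "\<forall>x\<in>#w. x \<in> occ" by (auto simp: occ_def)
      then show "g x \<noteq> None" if "x \<in># w" for x using that by (simp add: g_def)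
      show "(\<Sum>x\<in>#w. the (g x)) = U"
      proof -
        have "image_mset \<phi> (\<Sum>x\<in>#w. M x) + image_mset \<phi> P = U + image_mset \<phi> P"
          using full1[OF w] UP by simp
        then show ?thesis using g_sum[OF o] by simp
      qed
    qed
    then have "eval (S_c ?W) g t = Some U"
      using sat range_g by (auto simp: satisfies_def)
    then have t: "\<forall>x\<in>#image_mset fst R. g x \<noteq> None" "(\<Sum>x\<in>#image_mset fst R. the (g x)) = U"
      using ev R(1) by blast+
    have same: "image_mset \<phi> Q = the (g x)" if "(x, Q) \<in># R" for x Q
    proof -
      have "x \<in> occ" using t(1) that by (force simp: g_def split: if_splits)
      have "image_mset \<phi> ((Q + (\<Sum>y\<in>#c x - {#x#}. M y)) + P) = ?W"
        by (rule full[OF lang2 F2_I]) (use that \<open>x \<in> occ\<close> R(2) in blast)+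
      moreover have "image_mset \<phi> ((M x + (\<Sum>y\<in>#c x - {#x#}. M y)) + P) = ?W"
        using full1[of "c x"] c[OF \<open>x \<in> occ\<close>] unfolding split[OF \<open>x \<in> occ\<close>] by blast
      ultimately have "image_mset \<phi> ((Q + (\<Sum>y\<in>#c x - {#x#}. M y)) + P)
          = image_mset \<phi> ((M x + (\<Sum>y\<in>#c x - {#x#}. M y)) + P)" by simp
      then have "image_mset \<phi> Q = image_mset \<phi> (M x)" by simp
      then show ?thesis using \<open>x \<in> occ\<close> by (simp add: g_def)
    qed
    have "image_mset \<phi> (\<Sum>\<^sub># (image_mset snd R')) = (\<Sum>x\<in>#image_mset fst R'. the (g x))"
      if "\<forall>z\<in>#R'. image_mset \<phi> (snd z) = the (g (fst z))" for R'
      using that by (induction R') auto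
    from this[of R] have "image_mset \<phi> N = U" using same t(2) by (simp add: N)
    then show ?thesis using UP by simp
  qed
  \<comment> \<open>A rainbow colouring exists; the lemma on separating colourings asks for two vertices.\<close>
  have "\<exists>u v :: 'v. u \<noteq> v"
  proof -
    obtain w where "w \<in> words s" using words_nonempty by blast
    then have "card (set_mset ((\<Sum>x\<in>#w. M x) + P)) = k" using edge lang1 uni by blast
    then show ?thesis using \<open>k \<ge> 3\<close>
      by (metis card_le_Suc0_iff_eq finite_set_mset Suc_n_not_le_n le_trans numeral_3_eq_3 le_SucI)
  qed
  moreover have uF: "\<And>e. e \<in> F \<Longrightarrow> finite e \<and> card e = k" using FE uni by blast
  ultimately obtain \<phi> where "rainbow k F \<phi>"
    using cycle_free_rainbow_distinct[OF \<open>finite F\<close> cf uF \<open>k \<ge> 3\<close>] by blast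
  from image_mset_eq_mset_setD[OF col[OF this]]
  have NP: "N + P = mset_set (set_mset (N + P))" "card (set_mset (N + P)) = k" by simp_all
  have "set_mset (N + P) \<in> F"
  proof (rule always_rainbow_imp_edge[OF \<open>finite F\<close> cf uF \<open>k \<ge> 3\<close> finite_set_mset NP(2)])
    show "inj_on \<phi> (set_mset (N + P))" if "rainbow k F \<phi>" for \<phi>
      using image_mset_eq_mset_setD(2)[OF col[OF that]] by simp
  qed
  then show "N + P \<in> mset_set ` E" using FE NP(1) by blast
qed

lemma satisfies_syntactic_edges:
  assumes "satisfies (S_c (mset_set {1..k})) (s, t)" "k \<ge> 3"
    "hypergraph (V, E)" "uniform k (V, E)"
    "\<And>w. w \<in> words s \<union> words t \<Longrightarrow> enat (card (words s) + card (words t) + size w) < girth (V, E)"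
  shows "satisfies (syntactic (mset_set ` E)) (s, t)"
proof (rule satisfies_syntacticI)
  fix X :: "'a \<Rightarrow> 'b multiset set" and P
  assume X: "\<And>x. X x \<noteq> {}" "\<And>x. {#} \<notin> X x"
  have sym: "satisfies (S_c (mset_set {1..k})) (t, s)" using assms(1) by (auto simp: satisfies_def)
  have size: "enat (card (words s) + size w) < girth (V, E)" if "w \<in> words t" for w
    using assms(5)[of w] that by (intro le_less_trans[OF _ assms(5)[of w]]) auto
  have size': "enat (card (words t) + size w) < girth (V, E)" if "w \<in> words s" for w
    using assms(5)[of w] that by (intro le_less_trans[OF _ assms(5)[of w]]) auto
  show "P \<in> contexts (mset_set ` E) (lang X s) \<longleftrightarrow> P \<in> contexts (mset_set ` E) (lang X t)"
  proof
    assume "P \<in> contexts (mset_set ` E) (lang X s)"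
    then show "P \<in> contexts (mset_set ` E) (lang X t)"
      using size X by (intro contexts_transfer[OF assms(1-4)])
  next
    assume "P \<in> contexts (mset_set ` E) (lang X t)"
    then show "P \<in> contexts (mset_set ` E) (lang X s)"
      using size' X by (intro contexts_transfer[OF sym assms(2-4)])
  qed
qed

section \<open>Identities and members of a fixed universe\<close>
instance ai_term :: (countable) countable
  by countable_datatype

lemma eval_cong: "(\<And>x. x \<in> set_ai_term t \<Longrightarrow> f x = g x) \<Longrightarrow> eval S f t = eval S g t"
  by (induction t) auto

lemma eval_map: "eval S f (map_ai_term e t) = eval S (f \<circ> e) t"
  by (induction t) auto

lemma finite_set_ai_term: "finite (set_ai_term t)"
  by (induction t) auto

text \<open>The variety is defined through identities over the natural numbers. As identities have
  finitely many variables, those of \<open>i\<close> can be renamed injectively to natural numbers.\<close>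
lemma satisfies_in_generated_variety:
  fixes i :: "'x ai_identity" and C :: "'c ai_alg" and T :: "'t ai_alg"
  assumes "C \<in> generated_variety T" "satisfies T i"
  shows "satisfies C i"
proof -
  obtain s t where i: "i = (s, t)" by (cases i)
  define X where "X = set_ai_term s \<union> set_ai_term t"
  have "finite X" by (simp add: X_def finite_set_ai_term)
  define e where "e = to_nat_on X"
  have e: "inj_on e X"
    unfolding e_def by (rule inj_on_to_nat_on[OF countable_finite[OF \<open>finite X\<close>]])
  let ?j = "(map_ai_term e s, map_ai_term e t)"
  have "eval T (f \<circ> e) s = eval T (f \<circ> e) t" if f: "range f \<subseteq> elems T" for f :: "nat \<Rightarrow> 't"
  proof -
    have "range (f \<circ> e) \<subseteq> elems T" using f by auto
    then show ?thesis using assms(2) unfolding i satisfies_def by blast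
  qed
  then have "satisfies T ?j" by (simp add: satisfies_def eval_map)
  then have C: "satisfies C ?j"
    using assms(1) by (simp add: generated_variety_eq variety_defined_by_def)
  show ?thesis
    unfolding i satisfies_def prod.case
  proof (intro allI impI)
    fix f :: "'x \<Rightarrow> 'c" assume f: "range f \<subseteq> elems C"
    let ?f = "f \<circ> inv_into X e"
    have "range ?f \<subseteq> elems C" using f by auto
    then have "eval C (?f \<circ> e) s = eval C (?f \<circ> e) t"
      using C by (simp add: satisfies_def eval_map)
    moreover have "(?f \<circ> e) x = f x" if "x \<in> X" for x
      using inv_into_f_f[OF e that] by simp
    then have "eval C (?f \<circ> e) s = eval C f s" "eval C (?f \<circ> e) t = eval C f t"
      by (intro eval_cong; simp add: X_def)+
    ultimately show "eval C f s = eval C f t" by simp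
  qed
qed

text \<open>The copy along \<open>h\<close> of the subalgebra of \<open>S\<close> with universe \<open>D\<close>.\<close>
definition transport :: "('a \<Rightarrow> 'u) \<Rightarrow> 'a set \<Rightarrow> 'a ai_alg \<Rightarrow> 'u ai_alg" where
  "transport h D S =
    \<lparr> elems = h ` D,
      add = (\<lambda>x y. h (add S (inv_into D h x) (inv_into D h y))),
      mul = (\<lambda>x y. h (mul S (inv_into D h x) (inv_into D h y))) \<rparr>"

context
  fixes S :: "'a ai_alg" and D :: "'a set" and h :: "'a \<Rightarrow> 'u"
  assumes S: "ai_semiring S" and D: "D \<subseteq> elems S" "D \<noteq> {}"
    and closed: "\<And>x y. x \<in> D \<Longrightarrow> y \<in> D \<Longrightarrow> add S x y \<in> D"
      "\<And>x y. x \<in> D \<Longrightarrow> y \<in> D \<Longrightarrow> mul S x y \<in> D"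
    and inj: "inj_on h D"
begin

lemma transport_simps:
  "elems (transport h D S) = h ` D"
  "x \<in> D \<Longrightarrow> y \<in> D \<Longrightarrow> add (transport h D S) (h x) (h y) = h (add S x y)"
  "x \<in> D \<Longrightarrow> y \<in> D \<Longrightarrow> mul (transport h D S) (h x) (h y) = h (mul S x y)"
  using inj by (auto simp: transport_def)

lemma eval_transport:
  assumes "range f \<subseteq> D"
  shows "eval S f t \<in> D \<and> eval (transport h D S) (\<lambda>x. h (f x)) t = h (eval S f t)"
  using assms by (induction t) (auto simp: transport_simps closed)

lemma ai_semiring_transport: "ai_semiring (transport h D S)"
proof -
  interpret ai_semiring S by (rule S)
  have mem: "x \<in> elems S" if "x \<in> D" for x using that D by blast
  have comm: "h (add S x y) = h (add S y x)" if "x \<in> D" "y \<in> D" for x y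
    using add_comm[OF mem mem] that by simp
  show ?thesis
  proof
    show "elems (transport h D S) \<noteq> {}" using D by (simp add: transport_simps)
  qed (auto simp: transport_simps closed mem add_assoc add_idem mul_assoc distrib_left distrib_right
      intro: comm)
qed

lemma satisfies_transport:
  fixes i :: "'x ai_identity"
  assumes "satisfies S i"
  shows "satisfies (transport h D S) i"
proof -
  obtain s t where i: "i = (s, t)" by (cases i)
  show ?thesis
    unfolding i satisfies_def prod.case
  proof (intro allI impI)
    fix g :: "'x \<Rightarrow> 'u" assume "range g \<subseteq> elems (transport h D S)"
    then have "\<forall>x. \<exists>y. y \<in> D \<and> g x = h y" by (auto simp: transport_simps)
    then obtain f where f: "\<And>x. f x \<in> D" "\<And>x. g x = h (f x)" by metis
    have g: "g = (\<lambda>x. h (f x))" using f(2) by auto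
    have "range f \<subseteq> D" using f(1) by auto
    moreover from this have "eval S f s = eval S f t"
      using assms D(1) unfolding i satisfies_def by blast
    ultimately show "eval (transport h D S) g s = eval (transport h D S) g t"
      using eval_transport[of f] unfolding g by simp
  qed
qed

end

text \<open>If \<open>i\<close> fails in \<open>B\<close> then it fails in the subalgebra generated by the finitely many values
  of its variables. This subalgebra is countable, hence it has a copy in the infinite type \<open>'u\<close>.\<close>
lemma satisfies_if_generated_variety:
  fixes i :: "'x ai_identity"
  assumes B: "ai_semiring B"
    and sat: "\<And>C :: 'u::infinite ai_alg. C \<in> generated_variety B \<Longrightarrow> satisfies C i"
  shows "satisfies B i"
proof -
  obtain s t where i: "i = (s, t)" by (cases i)
  show ?thesis
    unfolding i satisfies_def prod.case
  proof (intro allI impI)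
    fix f :: "'x \<Rightarrow> 'a" assume f: "range f \<subseteq> elems B"
    define X where "X = insert undefined (set_ai_term s \<union> set_ai_term t)"
    have "countable (f ` X)" by (simp add: X_def finite_set_ai_term countable_finite)
    define g where "g = from_nat_into (f ` X)"
    have g: "range g = f ` X"
      unfolding g_def by (rule range_from_nat_into[OF _ \<open>countable (f ` X)\<close>]) (simp add: X_def)
    \<comment> \<open>The subalgebra generated by the range of \<open>g\<close>, which is countable as there are countably
      many terms.\<close>
    define D where "D = range (\<lambda>u :: nat ai_term. eval B g u)"
    have "countable D" unfolding D_def by blast
    have "range g \<subseteq> elems B" using f g by auto
    then have DB: "D \<subseteq> elems B" unfolding D_def
    proof -
      interpret ai_semiring B by (rule B)
      have "eval B g u \<in> elems B" for u
        using \<open>range g \<subseteq> elems B\<close> by (induction u) (auto intro: add_closed mul_closed)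
      then show "range (\<lambda>u :: nat ai_term. eval B g u) \<subseteq> elems B" by blast
    qed
    have gD: "range g \<subseteq> D"
    proof
      fix y assume "y \<in> range g"
      then obtain n where "y = eval B g (Var n)" by auto
      then show "y \<in> D" unfolding D_def by blast
    qed
    have "D \<noteq> {}" by (simp add: D_def)
    have closed: "add B x y \<in> D" "mul B x y \<in> D" if xy: "x \<in> D" "y \<in> D" for x y
    proof -
      obtain a b where "x = eval B g a" "y = eval B g b" using xy by (auto simp: D_def)
      then have "add B x y = eval B g (Plus a b)" "mul B x y = eval B g (Times a b)" by simp_all
      then show "add B x y \<in> D" "mul B x y \<in> D" unfolding D_def by blast+
    qed
    obtain e :: "nat \<Rightarrow> 'u" where "inj e"
      using infinite_countable_subset[OF infinite_UNIV] by blast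
    define h where "h = e \<circ> to_nat_on D"
    have h: "inj_on h D"
      unfolding h_def using inj_on_to_nat_on[OF \<open>countable D\<close>] \<open>inj e\<close>
      by (intro comp_inj_on) (auto intro: inj_on_subset)
    note tr = B DB \<open>D \<noteq> {}\<close> closed h
    let ?C = "transport h D B"
    have "?C \<in> generated_variety B"
      unfolding generated_variety_eq variety_defined_by_def
      using ai_semiring_transport[OF tr] satisfies_transport[OF tr] by blast
    then have C: "satisfies ?C (s, t)" using sat i by blast
    define f' where "f' x = (if x \<in> X then f x else g 0)" for x
    have f': "range f' \<subseteq> D" using g gD by (auto simp: f'_def)
    have "range (\<lambda>x. h (f' x)) \<subseteq> elems ?C" using f' transport_simps(1)[OF tr] by auto
    then have "eval ?C (\<lambda>x. h (f' x)) s = eval ?C (\<lambda>x. h (f' x)) t"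
      using C unfolding satisfies_def by blast
    then have "h (eval B f' s) = h (eval B f' t)" "eval B f' s \<in> D" "eval B f' t \<in> D"
      using eval_transport[OF tr f'] by auto
    then have "eval B f' s = eval B f' t" using h by (auto dest: inj_onD)
    moreover have "eval B f' s = eval B f s" "eval B f' t = eval B f t"
      by (rule eval_cong, simp add: f'_def X_def)+
    ultimately show "eval B f s = eval B f t" by simp
  qed
qed

section \<open>Adjoining a zero\<close>
lemma eval_adjoin_zero_Some:
  "eval (adjoin_zero S) (\<lambda>x. Some (f x)) t = Some (eval S f t)"
  by (induction t) (simp_all add: adjoin_zero_def)

lemma satisfies_adjoin_zeroD:
  fixes i :: "'x ai_identity"
  assumes "satisfies (adjoin_zero S) i"
  shows "satisfies S i"
proof -
  obtain s t where i: "i = (s, t)" by (cases i)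
  have "eval S f s = eval S f t" if "range f \<subseteq> elems S" for f
  proof -
    have "range (\<lambda>x. Some (f x)) \<subseteq> elems (adjoin_zero S)" using that by (auto simp: adjoin_zero_def)
    then have "eval (adjoin_zero S) (\<lambda>x. Some (f x)) s = eval (adjoin_zero S) (\<lambda>x. Some (f x)) t"
      using assms unfolding i satisfies_def by blast
    then show ?thesis by (simp add: eval_adjoin_zero_Some)
  qed
  then show ?thesis by (simp add: i satisfies_def)
qed

lemma set_ai_term_word: "ws \<noteq> [] \<Longrightarrow> set_ai_term (word ws) = set ws"
  by (induction ws rule: word.induct) auto

lemma eval_word_adjoin_zero_None:
  "x \<in> set ws \<Longrightarrow> f x = None \<Longrightarrow> eval (adjoin_zero S) f (word ws) = None"
  by (induction ws rule: word.induct) (auto simp: adjoin_zero_def split: option.splits)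

text \<open>If some variable of the word has the value \<open>0\<close>, then so has the word, and \<open>0\<close> is additively
  neutral. Otherwise the assignment takes its values in \<open>S\<close> on all variables of the identity.\<close>
lemma satisfies_adjoin_zero:
  fixes S :: "'s ai_alg" and t :: "'x ai_term"
  assumes S: "ai_semiring S" and sat: "satisfies S (t, Plus t (word ws))"
    and ws: "ws \<noteq> []" "set_ai_term t \<subseteq> set ws"
  shows "satisfies (adjoin_zero S) (t, Plus t (word ws))"
  unfolding satisfies_def prod.case
proof (intro allI impI)
  fix f :: "'x \<Rightarrow> 's option" assume f: "range f \<subseteq> elems (adjoin_zero S)"
  show "eval (adjoin_zero S) f t = eval (adjoin_zero S) f (Plus t (word ws))"
  proof (cases "\<exists>x\<in>set ws. f x = None")
    case True
    then have "eval (adjoin_zero S) f (word ws) = None" using eval_word_adjoin_zero_None by metis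
    then show ?thesis by (simp add: adjoin_zero_def split: option.splits)
  next
    case False
    obtain a where a: "a \<in> elems S" using ai_semiring.nonempty[OF S] by blast
    define f' where "f' x = (if x \<in> set ws then the (f x) else a)" for x
    have fx: "f x = Some (f' x)" if "x \<in> set ws" for x using that False by (auto simp: f'_def)
    have "f' x \<in> elems S" for x
    proof (cases "x \<in> set ws")
      case True
      have "f x \<in> elems (adjoin_zero S)" using f by blast
      then show ?thesis using fx[OF True] by (auto simp: adjoin_zero_def)
    qed (simp add: f'_def a)
    then have "range f' \<subseteq> elems S" by blast
    then have "eval S f' t = eval S f' (Plus t (word ws))" using sat by (simp add: satisfies_def)
    moreover have "eval (adjoin_zero S) f u = Some (eval S f' u)" if "set_ai_term u \<subseteq> set ws" for u
      unfolding eval_adjoin_zero_Some[symmetric] by (rule eval_cong) (use fx that in blast)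
    ultimately show ?thesis using ws set_ai_term_word[OF ws(1)] by (metis Un_least ai_term.set(2) subset_refl)
  qed
qed

section \<open>The identities of a hypergraph\<close>
lemma words_word: "ws \<noteq> [] \<Longrightarrow> words (word ws) = {mset ws}"
  by (induction ws rule: word.induct) (auto simp: sumset_def)

lemma words_sum_terms: "ts \<noteq> [] \<Longrightarrow> words (sum_terms ts) = (\<Union>t\<in>set ts. words t)"
  by (induction ts rule: sum_terms.induct) auto

lemma set_ai_term_sum_terms:
  "ts \<noteq> [] \<Longrightarrow> set_ai_term (sum_terms ts) = (\<Union>t\<in>set ts. set_ai_term t)"
  by (induction ts rule: sum_terms.induct) auto

lemma sum_words:
  assumes "finite W" "W \<noteq> {}" "[] \<notin> W"
  shows words_sum_words: "words (sum_words W) = mset ` W"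
    and set_ai_term_sum_words: "set_ai_term (sum_words W) = \<Union>(set ` W)"
proof -
  let ?ws = "SOME ws. distinct ws \<and> set ws = W"
  have "\<exists>ws. distinct ws \<and> set ws = W" using finite_distinct_list[OF assms(1)] by blast
  then have ws: "set ?ws = W" by (rule someI2_ex) simp
  then have "?ws \<noteq> []" using assms(2) by (metis list.set(1))
  then have ne: "map word ?ws \<noteq> []" by (simp only: map_is_Nil_conv) simp
  have w: "words (word w) = {mset w}" "set_ai_term (word w) = set w" if "w \<in> W" for w
  proof -
    have "w \<noteq> []" using assms(3) that by blast
    then show "words (word w) = {mset w}" "set_ai_term (word w) = set w"
      by (rule words_word, rule set_ai_term_word)
  qed
  have "words (sum_words W) = (\<Union>w\<in>W. words (word w))"
    unfolding sum_words_def words_sum_terms[OF ne] set_map ws by blast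
  also have "\<dots> = (\<Union>w\<in>W. {mset w})" by (rule SUP_cong[OF refl w(1)])
  finally show "words (sum_words W) = mset ` W" by blast
  have "set_ai_term (sum_words W) = (\<Union>w\<in>W. set_ai_term (word w))"
    unfolding sum_words_def set_ai_term_sum_terms[OF ne] set_map ws by blast
  also have "\<dots> = \<Union>(set ` W)" by (rule SUP_cong[OF refl w(2)])
  finally show "set_ai_term (sum_words W) = \<Union>(set ` W)" .
qed

text \<open>Assign to each variable \<open>x\<close> the class of the one-letter word \<open>x\<close>: then \<open>{#}\<close> is a context of
  the value of a term exactly if all words of the term are in \<open>L\<close>.\<close>
lemma syntactic_words:
  assumes "satisfies (syntactic L) (s, t)" "words s \<subseteq> L"
  shows "words t \<subseteq> L"
proof -
  let ?f = "\<lambda>x. contexts L {{#x#}}"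
  have "?f x \<in> elems (syntactic L)" for x
    unfolding in_elems_syntactic by (intro exI[of _ "{{#x#}}"]) simp
  then have "range ?f \<subseteq> elems (syntactic L)" by blast
  then have "eval (syntactic L) ?f s = eval (syntactic L) ?f t"
    using assms(1) unfolding satisfies_def by blast
  then have "contexts L (words s) = contexts L (words t)"
    by (simp add: eval_syntactic words_def)
  moreover have empty: "{#} \<in> contexts L X \<longleftrightarrow> X \<subseteq> L" for X by (auto simp: contexts_def)
  ultimately show ?thesis using assms(2) empty[of "words s"] empty[of "words t"] by simp
qed

text \<open>If the set of all vertices is an edge then it is the only one, by uniformity, and two
  colours suffice.\<close>
lemma not_colourable_edges:
  assumes "hypergraph (V, E)" "uniform k (V, E)" "\<not> colourable m (V, E)" "k \<ge> 2" "m \<ge> 2"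
  shows "E \<noteq> {}" "V \<notin> E"
proof -
  show "E \<noteq> {}"
  proof
    assume "E = {}"
    then have "colourable m (V, E)"
      using assms(5) unfolding colourable_def prod.case by (intro exI[of _ "\<lambda>_. 1"]) auto
    then show False using assms(3) by simp
  qed
  show "V \<notin> E"
  proof
    assume "V \<in> E"
    then have V: "finite V" "card V = k" using assms(2) by (auto simp: uniform_def)
    have EV: "e = V" if "e \<in> E" for e
    proof -
      have "e \<subseteq> V" "card e = card V"
        using that assms(1,2) V by (auto simp: uniform_def hypergraph_def)
      then show ?thesis using card_subset_eq[OF V(1)] by blast
    qed
    have "\<not> card V \<le> Suc 0" using V assms(4) by simp
    then obtain a b where ab: "a \<in> V" "b \<in> V" "a \<noteq> b"
      using card_le_Suc0_iff_eq[OF V(1)] by blast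
    define \<phi> :: "'a \<Rightarrow> nat" where "\<phi> v = (if v = a then 1 else 2)" for v
    have "\<phi> ` V = {1, 2}" using ab by (auto simp: \<phi>_def image_iff)
    then have "colourable m (V, E)"
      using assms(5) unfolding colourable_def prod.case
      by (intro exI[of _ \<phi>]) (auto dest!: EV)
    then show False using assms(3) by simp
  qed
qed

lemma t_term:
  assumes "hypergraph (V, E)" "uniform k (V, E)" "finite V" "E \<noteq> {}" "k > 0"
  shows words_t_term: "words (t_term k (V, E)) \<subseteq> mset_set ` E"
    and set_ai_term_t_term: "set_ai_term (t_term k (V, E)) \<subseteq> V"
proof -
  let ?W = "{vs. length vs = k \<and> set vs \<in> E}"
  have EV: "e \<subseteq> V" if "e \<in> E" for e using that assms(1) by (auto simp: hypergraph_def)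
  have uni: "finite e \<and> card e = k" if "e \<in> E" for e using that assms(2) by (auto simp: uniform_def)
  have "?W \<subseteq> {vs. set vs \<subseteq> V \<and> length vs = k}" using EV by auto
  then have fin: "finite ?W" using finite_lists_length_eq[OF assms(3)] finite_subset by blast
  have ne: "?W \<noteq> {}"
  proof -
    obtain e where e: "e \<in> E" using assms(4) by blast
    then obtain vs where "set vs = e" "distinct vs" using finite_distinct_list uni by blast
    then have "vs \<in> ?W" using e uni distinct_card by fastforce
    then show ?thesis by blast
  qed
  have "[] \<notin> ?W" using assms(5) by simp
  note W = fin ne this
  have "mset vs = mset_set (set vs)" if "vs \<in> ?W" for vs
  proof -
    have "distinct vs" using that uni by (intro card_distinct) auto
    then show ?thesis by (simp add: mset_set_set)
  qed
  then show "words (t_term k (V, E)) \<subseteq> mset_set ` E"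
    unfolding t_term_def prod.case words_sum_words[OF W] by auto
  show "set_ai_term (t_term k (V, E)) \<subseteq> V"
    unfolding t_term_def prod.case set_ai_term_sum_words[OF W] using EV by auto
qed

section \<open>Nonfinitely based varieties\<close>
text \<open>An upper bound for the number of edges that occur in the verification of the identity in
  the syntactic ai-semiring of a hypergraph.\<close>
definition complexity :: "'x ai_identity \<Rightarrow> nat" where
  "complexity = (\<lambda>(s, t). card (words s) + card (words t) + Max (size ` (words s \<union> words t)))"

text \<open>In particular, the girth of \<open>\<bbbH>\<^sub>n\<close> exceeds any given bound for some \<open>n\<close>.\<close>
lemma le_mult_choose_two:
  assumes "k \<ge> 3"
  shows "n \<le> k * ((k * n) choose 2)"
proof (cases "n = 0")
  case False
  let ?p = "k * n"
  have "?p \<ge> 3" using assms False by (metis One_nat_def Suc_leI le_trans mult_le_mono nat_mult_1_right neq0_conv)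
  then have "?p * 2 \<le> ?p * (?p - 1)" by (intro mult_le_mono) auto
  from div_le_mono[OF this, of 2] have "?p \<le> ?p choose 2" unfolding choose_two by simp
  moreover have "n \<le> ?p" "(?p choose 2) \<le> k * (?p choose 2)" using assms by auto
  ultimately show ?thesis by linarith
qed simp

lemma syntactic_satisfies_if_complexity_less_girth:
  assumes "satisfies (S_c (mset_set {1..k})) i" "k \<ge> 3" "hypergraph (V, E)" "uniform k (V, E)"
    "enat (complexity i) < girth (V, E)"
  shows "satisfies (syntactic (mset_set ` E)) i"
proof -
  obtain s t where i: "i = (s, t)" by (cases i)
  show ?thesis
    unfolding i
  proof (rule satisfies_syntactic_edges[OF _ assms(2-4)])
    show "satisfies (S_c (mset_set {1..k})) (s, t)" using assms(1) i by simp
    fix w assume "w \<in> words s \<union> words t"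
    then have "size w \<le> Max (size ` (words s \<union> words t))"
      by (intro Max_ge) (auto simp: finite_words)
    then have "enat (card (words s) + card (words t) + size w) \<le> enat (complexity i)"
      by (simp add: i complexity_def)
    then show "enat (card (words s) + card (words t) + size w) < girth (V, E)"
      using assms(5) by (rule order_le_less_trans)
  qed
qed

text \<open>For a finite basis \<open>\<Sigma>\<close>, choose \<open>n\<close> such that the girth of \<open>\<bbbH>\<^sub>n\<close> exceeds the complexity of all
  identities in \<open>\<Sigma>\<close>. Then the syntactic ai-semiring of the edges satisfies \<open>\<Sigma>\<close>, so that all its
  copies in \<open>'u\<close> lie in the variety of \<open>T\<close>, but it does not satisfy the identity of \<open>\<bbbH>\<^sub>n\<close>.\<close>
lemma not_finitely_based_if_hypergraph_identities:
  fixes H :: "nat \<Rightarrow> 'v hypergraph_pair" and T :: "'t ai_alg"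
  assumes k: "k \<ge> 3" and m: "m \<ge> 3"
    and H: "\<And>n. n \<ge> 3 \<Longrightarrow> admissible k m n (H n)"
    and vs: "\<And>n. n \<ge> 3 \<Longrightarrow> distinct (vs n) \<and> set (vs n) = fst (H n)"
    and T: "\<And>n. n \<ge> 3 \<Longrightarrow> satisfies T (t_term k (H n), Plus (t_term k (H n)) (word (vs n)))"
    and T': "ai_semiring T"
    and S_c: "\<And>i :: nat ai_identity. satisfies T i \<Longrightarrow> satisfies (S_c (mset_set {1..k})) i"
  shows "\<not> finitely_based (generated_variety T :: 'u::infinite ai_alg set)"
proof
  assume "finitely_based (generated_variety T :: 'u ai_alg set)"
  then obtain \<Sigma> :: "nat ai_identity set"
    where fin: "finite \<Sigma>" and \<Sigma>: "(generated_variety T :: 'u ai_alg set) = variety_defined_by \<Sigma>"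
    by (auto simp: finitely_based_def)
  have sat: "satisfies (S_c (mset_set {1..k})) i" if i: "i \<in> \<Sigma>" for i
  proof (rule S_c, rule satisfies_if_generated_variety[OF T'])
    fix C :: "'u ai_alg" assume "C \<in> generated_variety T"
    then show "satisfies C i" using i unfolding \<Sigma> variety_defined_by_def by blast
  qed
  define n where "n = Max (insert 3 (complexity ` \<Sigma>))"
  have n: "n \<ge> 3" and cn: "\<And>i. i \<in> \<Sigma> \<Longrightarrow> complexity i \<le> n" using fin by (auto simp: n_def)
  obtain V E where VE: "H n = (V, E)" by (cases "H n")
  from H[OF n] have adm: "hypergraph (V, E)" "finite V" "uniform k (V, E)"
    "enat (k * ((k * n) choose 2)) < girth (V, E)" "\<not> colourable m (V, E)"
    by (auto simp: admissible_def VE)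
  have E: "E \<noteq> {}" "V \<notin> E" using not_colourable_edges[OF adm(1,3,5)] k m by auto
  let ?A = "syntactic (mset_set ` E)"
  have A\<Sigma>: "satisfies ?A i" if i: "i \<in> \<Sigma>" for i
  proof (rule syntactic_satisfies_if_complexity_less_girth[OF sat[OF i] k adm(1,3)])
    have "complexity i \<le> k * ((k * n) choose 2)"
      using cn[OF i] le_mult_choose_two[OF k] by (rule le_trans)
    then show "enat (complexity i) < girth (V, E)"
      using adm(4) by (meson enat_ord_simps(1) order_le_less_trans)
  qed
  let ?i = "(t_term k (V, E), Plus (t_term k (V, E)) (word (vs n)))"
  have "satisfies ?A ?i"
  proof (rule satisfies_if_generated_variety[OF ai_semiring_syntactic])
    fix C :: "'u ai_alg" assume "C \<in> generated_variety ?A"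
    then have "C \<in> variety_defined_by \<Sigma>"
      using A\<Sigma> unfolding generated_variety_eq variety_defined_by_def by blast
    then have "C \<in> generated_variety T" unfolding \<Sigma> .
    then show "satisfies C ?i" by (rule satisfies_in_generated_variety) (use T[OF n] VE in simp)
  qed
  then have "words (Plus (t_term k (V, E)) (word (vs n))) \<subseteq> mset_set ` E"
    by (rule syntactic_words) (rule words_t_term; use adm E k in simp)
  moreover have vsV: "distinct (vs n)" "set (vs n) = V" using vs[OF n] VE by auto
  moreover have "vs n \<noteq> []"
  proof
    assume "vs n = []"
    then have "V = {}" using vsV by simp
    then show False using E adm(1) by (auto simp: hypergraph_def)
  qed
  ultimately have "mset (vs n) \<in> mset_set ` E" by (simp add: words_word)
  then obtain e where e: "e \<in> E" "mset (vs n) = mset_set e" by blast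
  have "finite e" using e(1) adm(3) by (auto simp: uniform_def)
  then have "set (vs n) = e" using arg_cong[OF e(2), of set_mset] by simp
  then show False using e(1) E(2) vsV(2) by simp
qed

theorem corollary4p5:
  fixes k m :: nat
    and H :: "nat \<Rightarrow> 'v hypergraph_pair"
    and vs :: "nat \<Rightarrow> 'v list"
    and S :: "'s ai_alg"
  assumes "k \<ge> 3" and "m \<ge> 3"
    and "\<And>n. n \<ge> 3 \<Longrightarrow> admissible k m n (H n)"
    and "\<And>n. n \<ge> 3 \<Longrightarrow> distinct (vs n) \<and> set (vs n) = fst (H n)"
    and "ai_semiring S"
    and "(generated_variety (S_c (mset_set {1..k})) :: 'u::infinite ai_alg set)
      \<subseteq> generated_variety S"
    and "(generated_variety S :: 'u ai_alg set) \<subseteq> W_variety k H vs"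
  shows "\<not> finitely_based (generated_variety S :: 'u ai_alg set)
    \<and> \<not> finitely_based (generated_variety (adjoin_zero S) :: 'u ai_alg set)"
proof
  let ?i = "\<lambda>n. (t_term k (H n), Plus (t_term k (H n)) (word (vs n)))"
  have S: "satisfies S (?i n)" if n: "n \<ge> 3" for n
  proof (rule satisfies_if_generated_variety[OF assms(5)])
    fix C :: "'u ai_alg" assume "C \<in> generated_variety S"
    then have "C \<in> W_variety k H vs" using assms(7) by blast
    then show "satisfies C (?i n)" using n unfolding W_variety_def variety_defined_by_def by blast
  qed
  have S_c: "satisfies (S_c (mset_set {1..k})) i" if i: "satisfies S i" for i :: "nat ai_identity"
  proof (rule satisfies_if_generated_variety[OF ai_semiring_S_c])
    fix C :: "'u ai_alg" assume "C \<in> generated_variety (S_c (mset_set {1..k}))"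
    then show "satisfies C i" using assms(6) satisfies_in_generated_variety[OF _ i] by blast
  qed
  show "\<not> finitely_based (generated_variety S :: 'u ai_alg set)"
    using not_finitely_based_if_hypergraph_identities[OF assms(1-4) S assms(5) S_c] .
  have S0: "satisfies (adjoin_zero S) (?i n)" if n: "n \<ge> 3" for n
  proof -
    obtain V E where VE: "H n = (V, E)" by (cases "H n")
    from assms(3)[OF n] have adm: "hypergraph (V, E)" "finite V" "uniform k (V, E)"
      "\<not> colourable m (V, E)" by (auto simp: admissible_def VE)
    have E: "E \<noteq> {}" using not_colourable_edges(1)[OF adm(1,3,4)] assms(1,2) by simp
    have vsV: "set (vs n) = V" using assms(4)[OF n] VE by simp
    show ?thesis
    proof (rule satisfies_adjoin_zero[OF assms(5) S[OF n]])
      show "vs n \<noteq> []"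
      proof
        assume "vs n = []"
        then have "V = {}" using vsV by simp
        then show False using E adm(1) by (auto simp: hypergraph_def)
      qed
      show "set_ai_term (t_term k (H n)) \<subseteq> set (vs n)"
        unfolding VE vsV by (rule set_ai_term_t_term) (use adm E assms(1) in simp_all)
    qed
  qed
  show "\<not> finitely_based (generated_variety (adjoin_zero S) :: 'u ai_alg set)"
    using not_finitely_based_if_hypergraph_identities[OF assms(1-4) S0
        ai_semiring_adjoin_zero[OF assms(5)] S_c[OF satisfies_adjoin_zeroD]] .
qed

end
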